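(* If a graph $G$ admits a generalized $d$-rigid partition, then $G$ is $d$-rigid.
   Context: Anchored graphs: let $H=(V,E)$ be a multigraph and $c:E\to\mathbb{N}$ a colouring of its edges; let $\{x_i\}_{i\in c(E)}\subseteq\mathbb{R}^d$ be a generic set of points. A map $\mathbf{q}:V\to\mathbb{R}^d$ is a motion of $(H,c)$ if $(\mathbf{q}(u)-\mathbf{q}(v))\cdot x_{c(e)}=0$ for every edge $e$ with endpoints $u,v$; it is trivial if $\mathbf{q}$ is constant. $(H,c)$ is $d$-anchored if every motion of it is trivial. Generalized $d$-rigid partition: let $G=(V,E)$ be a graph, $m\ge d\ge 1$, and $V_1,\dots,V_m$ a partition of $V$ into nonempty sets. For each $i\in[m]$ let $m_i\ge m$, and let $\mathcal{I}=\{(i,j):1\le i\le m,\ i<j\le m_i\}$. Let $\{G_{ij}\}_{(i,j)\in\mathcal{I}}$ be pairwise edge-disjoint subgraphs of $G$ with $V(G_{ij})=V_i\cup V_j$ for $1\le i<j\le m$ and $V(G_{ij})=V_i$ for $m<j\le m_i$; set $G_{ij}=G_{ji}$ for $1\le j<i\le m$, and $\hat G=\bigcup_{(i,j)\in\mathcal{I}}G_{ij}$. The reduced graph is $G'=([m],E')$ with $\{i,j\}\in E'$ iff $G_{ij}$ has an edge with one endpoint in $V_i$ and the other in $V_j$. The $i$-th anchoring graph $(H_i,c_i)$ is the edge-coloured multigraph on $V_i$ having, for each $j\in[m_i]\setminus\{i\}$, an edge $\{u,v\}$ of colour $j$ whenever $u,v$ are connected by a path in $G_{ij}$. The pair $(\{V_i\}_{i=1}^m,\{G_{ij}\}_{(i,j)\in\mathcal{I}})$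 is a generalized $d$-rigid partition of $G$ if: (1) (monochromatic cuts) for every $i\in[m]$ and $U\subseteq V_i$ with $|U|\ge 2$, there exist $(i,j)\in\mathcal{I}$ and a partition $U=U'\cup U''$ such that every edge of $\hat G$ between $U'$ and $U''$ belongs to $G_{ij}$; (2) (anchored parts) each $(H_i,c_i)$ is $d$-anchored; (3) the reduced graph $G'$ is $d$-rigid. Rigidity: a $d$-dimensional framework $(G,\mathbf{p})$ is rigid if every continuous edge-length-preserving motion of the vertices starting at $\mathbf{p}$ preserves all pairwise distances; $\mathbf{p}$ is generic if its coordinates are algebraically independent over $\mathbb{Q}$; a graph is $d$-rigid if $(G,\mathbf{p})$ is rigid for some (equivalently, every) generic $\mathbf{p}:V\to\mathbb{R}^d$. *)

theory Defs
  imports "HOL-Analysis.Analysis" "HOL-Library.Poly_Mapping" "HOL-Library.Disjoint_Sets"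
begin

section \<open>Graphs and edge-coloured multigraphs\<close>

record 'v ugraph =
  verts :: "'v set"
  edges :: "'v set set"

definition fin_graph :: "'v ugraph \<Rightarrow> bool" where
  "fin_graph G \<longleftrightarrow> finite (verts G) \<and> (\<forall>e\<in>edges G. e \<subseteq> verts G \<and> card e = 2)"

definition subgraph :: "'v ugraph \<Rightarrow> 'v ugraph \<Rightarrow> bool" where
  "subgraph H G \<longleftrightarrow> fin_graph H \<and> verts H \<subseteq> verts G \<and> edges H \<subseteq> edges G"

definition graph_Union :: "'i set \<Rightarrow> ('i \<Rightarrow> 'v ugraph) \<Rightarrow> 'v ugraph" where
  "graph_Union I \<G> = \<lparr>verts = (\<Union>a\<in>I. verts (\<G> a)), edges = (\<Union>a\<in>I. edges (\<G> a))\<rparr>"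

definition connected_in :: "'v ugraph \<Rightarrow> 'v \<Rightarrow> 'v \<Rightarrow> bool" where
  "connected_in G u v \<longleftrightarrow>
     u \<in> verts G \<and> v \<in> verts G \<and> (u, v) \<in> {(a, b). {a, b} \<in> edges G}\<^sup>*"

text \<open>The edges of a multigraph are abstract objects, so distinct edges may have the same
  set of endpoints.\<close>

record ('v, 'e) coloured_multigraph =
  mverts :: "'v set"
  medges :: "'e set"
  mends :: "'e \<Rightarrow> 'v set"
  mcolour :: "'e \<Rightarrow> nat"


section \<open>Generic points\<close>

text \<open>A polynomial with rational coefficients in variables indexed by \<open>'i\<close> is an element of
  \<open>('i \<Rightarrow>\<^sub>0 nat) \<Rightarrow>\<^sub>0 rat\<close>: it maps each monomial (exponent vector) to its coefficient.\<close>

definition poly_eval :: "(('i \<Rightarrow>\<^sub>0 nat) \<Rightarrow>\<^sub>0 rat) \<Rightarrow> ('i \<Rightarrow> real) \<Rightarrow> real" where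
  "poly_eval P z =
     (\<Sum>\<mu>\<in>Poly_Mapping.keys P. of_rat (Poly_Mapping.lookup P \<mu>) *
        (\<Prod>i\<in>Poly_Mapping.keys \<mu>. z i ^ Poly_Mapping.lookup \<mu> i))"

definition alg_independent :: "'i set \<Rightarrow> ('i \<Rightarrow> real) \<Rightarrow> bool" where
  "alg_independent I z \<longleftrightarrow>
     (\<forall>P. (\<forall>\<mu>\<in>Poly_Mapping.keys P. Poly_Mapping.keys \<mu> \<subseteq> I) \<and> poly_eval P z = 0 \<longrightarrow> P = 0)"

definition generic :: "'i set \<Rightarrow> ('i \<Rightarrow> real ^ 'd::finite) \<Rightarrow> bool" where
  "generic S p \<longleftrightarrow> alg_independent (S \<times> UNIV) (\<lambda>(v, k). p v $ k)"


section \<open>Rigidity\<close>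

definition framework_motion ::
    "'v ugraph \<Rightarrow> ('v \<Rightarrow> real ^ 'd::finite) \<Rightarrow> (real \<Rightarrow> 'v \<Rightarrow> real ^ 'd) \<Rightarrow> bool" where
  "framework_motion G p \<gamma> \<longleftrightarrow>
     (\<forall>v\<in>verts G. continuous_on {0..1} (\<lambda>t. \<gamma> t v) \<and> \<gamma> 0 v = p v) \<and>
     (\<forall>u v. {u, v} \<in> edges G \<longrightarrow> (\<forall>t\<in>{0..1}. dist (\<gamma> t u) (\<gamma> t v) = dist (p u) (p v)))"

definition rigid_framework :: "'v ugraph \<Rightarrow> ('v \<Rightarrow> real ^ 'd::finite) \<Rightarrow> bool" where
  "rigid_framework G p \<longleftrightarrow>
     (\<forall>\<gamma>. framework_motion G p \<gamma> \<longrightarrow>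
       (\<forall>u\<in>verts G. \<forall>v\<in>verts G. \<forall>t\<in>{0..1}. dist (\<gamma> t u) (\<gamma> t v) = dist (p u) (p v)))"

text \<open>The dimension is \<open>CARD('d)\<close>, passed as a type argument.\<close>

definition d_rigid :: "'d::finite itself \<Rightarrow> 'v ugraph \<Rightarrow> bool" where
  "d_rigid TYPE('d) G \<longleftrightarrow>
     (\<exists>p :: 'v \<Rightarrow> real ^ 'd. generic (verts G) p \<and> rigid_framework G p)"


section \<open>Anchored graphs\<close>

definition anchor_motion ::
    "('v, 'e) coloured_multigraph \<Rightarrow> (nat \<Rightarrow> real ^ 'd::finite) \<Rightarrow> ('v \<Rightarrow> real ^ 'd) \<Rightarrow> bool" where
  "anchor_motion H x q \<longleftrightarrow>
     (\<forall>e\<in>medges H. \<forall>u v. mends H e = {u, v} \<longrightarrow> (q u - q v) \<bullet> x (mcolour H e) = 0)"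

text \<open>As for rigidity, whether all motions are trivial does not depend on the choice of the
  generic points, so it is required for some choice.\<close>

definition d_anchored :: "'d::finite itself \<Rightarrow> ('v, 'e) coloured_multigraph \<Rightarrow> bool" where
  "d_anchored TYPE('d) H \<longleftrightarrow>
     (\<exists>x :: nat \<Rightarrow> real ^ 'd. generic (mcolour H ` medges H) x \<and>
        (\<forall>q. anchor_motion H x q \<longrightarrow> (\<forall>u\<in>mverts H. \<forall>v\<in>mverts H. q u = q v)))"


section \<open>Generalized rigid partitions\<close>

definition index_pairs :: "nat \<Rightarrow> (nat \<Rightarrow> nat) \<Rightarrow> (nat \<times> nat) set" where
  "index_pairs m n = {(i, j). 1 \<le> i \<and> i \<le> m \<and> i < j \<and> j \<le> n i}"

text \<open>The family is given on pairs with \<open>i < j\<close> and extended by symmetry.\<close>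

definition sym_graph :: "(nat \<times> nat \<Rightarrow> 'v ugraph) \<Rightarrow> nat \<Rightarrow> nat \<Rightarrow> 'v ugraph" where
  "sym_graph \<G> i j = (if i < j then \<G> (i, j) else \<G> (j, i))"

definition reduced_graph ::
    "nat \<Rightarrow> (nat \<Rightarrow> 'v set) \<Rightarrow> (nat \<times> nat \<Rightarrow> 'v ugraph) \<Rightarrow> nat ugraph" where
  "reduced_graph m V \<G> =
     \<lparr>verts = {1..m},
      edges = {{i, j} | i j. i \<in> {1..m} \<and> j \<in> {1..m} \<and> i \<noteq> j \<and>
        (\<exists>u\<in>V i. \<exists>v\<in>V j. {u, v} \<in> edges (sym_graph \<G> i j))}\<rparr>"

text \<open>An edge \<open>({u, v}, j)\<close> has endpoints \<open>u\<close>, \<open>v\<close> and colour \<open>j\<close>.\<close>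

definition anchoring_graph ::
    "(nat \<Rightarrow> 'v set) \<Rightarrow> (nat \<Rightarrow> nat) \<Rightarrow> (nat \<times> nat \<Rightarrow> 'v ugraph) \<Rightarrow> nat
      \<Rightarrow> ('v, 'v set \<times> nat) coloured_multigraph" where
  "anchoring_graph V n \<G> i =
     \<lparr>mverts = V i,
      medges = {({u, v}, j) | u v j. u \<in> V i \<and> v \<in> V i \<and> u \<noteq> v \<and> j \<in> {1..n i} - {i} \<and>
        connected_in (sym_graph \<G> i j) u v},
      mends = fst,
      mcolour = snd\<rparr>"

text \<open>Below, \<open>n i\<close> is the number of colours $m_i$. In the cut condition the index \<open>j\<close> ranges over
  all of \<open>{1..n i} - {i}\<close>, in accordance with the convention $G_{ij} = G_{ji}$ and with the
  colours of the anchoring graph; restricting it to \<open>j > i\<close> would make the condition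
  unsatisfiable for \<open>i = m = n m\<close> whenever \<open>V m\<close> has two elements.\<close>

definition generalized_rigid_partition ::
    "'d::finite itself \<Rightarrow> 'v ugraph \<Rightarrow> nat \<Rightarrow> (nat \<Rightarrow> 'v set) \<Rightarrow> (nat \<Rightarrow> nat)
      \<Rightarrow> (nat \<times> nat \<Rightarrow> 'v ugraph) \<Rightarrow> bool" where
  "generalized_rigid_partition TYPE('d) G m V n \<G> \<longleftrightarrow>
     CARD('d) \<le> m \<and>
     (\<forall>i\<in>{1..m}. V i \<noteq> {}) \<and> disjoint_family_on V {1..m} \<and> (\<Union>i\<in>{1..m}. V i) = verts G \<and>
     (\<forall>i\<in>{1..m}. m \<le> n i) \<and>
     (\<forall>a\<in>index_pairs m n. subgraph (\<G> a) G) \<and>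
     disjoint_family_on (\<lambda>a. edges (\<G> a)) (index_pairs m n) \<and>
     (\<forall>(i, j)\<in>index_pairs m n. verts (\<G> (i, j)) = (if j \<le> m then V i \<union> V j else V i)) \<and>
     (\<forall>i\<in>{1..m}. \<forall>U. U \<subseteq> V i \<and> card U \<ge> 2 \<longrightarrow>
        (\<exists>j\<in>{1..n i} - {i}. \<exists>U' U''. U' \<noteq> {} \<and> U'' \<noteq> {} \<and> U' \<inter> U'' = {} \<and> U' \<union> U'' = U \<and>
           (\<forall>u\<in>U'. \<forall>v\<in>U''. {u, v} \<in> edges (graph_Union (index_pairs m n) \<G>) \<longrightarrow>
              {u, v} \<in> edges (sym_graph \<G> i j)))) \<and>
     (\<forall>i\<in>{1..m}. d_anchored TYPE('d) (anchoring_graph V n \<G> i)) \<and>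
     d_rigid TYPE('d) (reduced_graph m V \<G>)"

end

theory Submission
  imports Defs "HOL-Computational_Algebra.Polynomial"
begin

text \<open>At generic points rigidity is equivalent to infinitesimal rigidity. Both directions use that for two
  placements \<open>x\<close>, \<open>y\<close> with the same length of an edge, \<open>y - x\<close> satisfies the linear condition of that
  edge at the midpoint of \<open>x\<close> and \<open>y\<close>; the generic rank carries this from the edges to all pairs.

  For a generalized rigid partition, place each part \<open>V i\<close> at a single point \<open>P i\<close>, where the \<open>P i\<close>,
  including those for the colours \<open>i > m\<close>, are jointly generic. The monochromatic cuts move the vertices
  of a part apart along a curve such that each edge of \<open>\<G> (i, j)\<close>, suitably rescaled, tends to a
  nonzero multiple of \<open>P i - P j\<close>. A motion of the limit configuration is constant on each part, since
  the parts are anchored, and hence comes from a motion of the reduced graph at \<open>P\<close>, so it is trivial.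
  That every motion is trivial is an open condition, since no nonzero motion is then orthogonal to the
  trivial ones: it persists for a nearby point of the curve and then, being polynomial, at generic points.\<close>

section \<open>Families of rows\<close>

text \<open>The obstacle is that at the collapsed placement the edges inside a part have length
  zero, so the usual equations there say nothing about them. Directions and positions of edges are
  therefore kept as separate data. The one direction \<open>P i - P j\<close> serves all edges of
  \<open>\<G> (i, j)\<close>, and edge-disjointness makes this pair unambiguous. Along a path in
  \<open>\<G> (i, j)\<close> every edge then imposes orthogonality to the same vector, even where
  the path passes through \<open>V j\<close>, so its endpoints are related as by one edge of colour
  \<open>j\<close>. This is why anchoring graphs record connectivity, and why their points can be
  taken to be the differences \<open>P i - P j\<close>. \<open>lin_indep\<close> is used in two
  roles: with edges as rows, for ranks of rigidity matrices, and transposed, with coordinates as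
  rows, to say that a system of linear equations has only the zero solution. In both roles a single
  scalar function detects independence, so the spread to generic points and the stability under
  small changes are one argument for two rings of functions.\<close>

definition lin_indep :: "'r set \<Rightarrow> 'c set \<Rightarrow> ('r \<Rightarrow> 'c \<Rightarrow> real) \<Rightarrow> bool" where
  "lin_indep F C a \<longleftrightarrow>
     (\<forall>l. (\<forall>c\<in>C. (\<Sum>r\<in>F. l r * a r c) = 0) \<longrightarrow> (\<forall>r\<in>F. l r = 0))"

lemma lin_indepI:
  "(\<And>l r. (\<And>c. c \<in> C \<Longrightarrow> (\<Sum>r\<in>F. l r * a r c) = 0) \<Longrightarrow> r \<in> F \<Longrightarrow> l r = 0) \<Longrightarrow> lin_indep F C a"
  unfolding lin_indep_def by blast

lemma lin_indepD:
  "lin_indep F C a \<Longrightarrow> (\<And>c. c \<in> C \<Longrightarrow> (\<Sum>r\<in>F. l r * a r c) = 0) \<Longrightarrow> r \<in> F \<Longrightarrow> l r = 0"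
  unfolding lin_indep_def by blast

text \<open>Row \<open>e\<close> clears column \<open>c\<close> from the others. A relation
  \<open>l\<close> among the cleared rows lifts to one with coefficients \<open>a e c * l r\<close>
  and a correcting coefficient on \<open>e\<close>; conversely, once the other coefficients vanish,
  column \<open>c\<close> forces that of \<open>e\<close> to vanish.\<close>

lemma lin_indep_eliminate:
  assumes F: "finite F" "e \<notin> F" and c: "c \<in> C" "a e c \<noteq> 0"
  shows "lin_indep (insert e F) C a \<longleftrightarrow>
    lin_indep F C (\<lambda>r c'. a e c * a r c' - a r c * a e c')"
proof -
  have expand: "(\<Sum>r\<in>F. l r * (a e c * a r c' - a r c * a e c'))
      = a e c * (\<Sum>r\<in>F. l r * a r c') - (\<Sum>r\<in>F. l r * a r c) * a e c'" for l c'
    by (simp add: sum_distrib_left sum_distrib_right sum_subtractf[symmetric] algebra_simps)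
  show ?thesis
  proof
    assume ind: "lin_indep (insert e F) C a"
    show "lin_indep F C (\<lambda>r c'. a e c * a r c' - a r c * a e c')"
    proof (rule lin_indepI)
      fix l r
      assume z: "\<And>c'. c' \<in> C \<Longrightarrow> (\<Sum>r\<in>F. l r * (a e c * a r c' - a r c * a e c')) = 0" and r: "r \<in> F"
      define l' where "l' r = (if r = e then - (\<Sum>r\<in>F. l r * a r c) else a e c * l r)" for r
      have "(\<Sum>r\<in>insert e F. l' r * a r c') = 0" if "c' \<in> C" for c'
      proof -
        have "(\<Sum>r\<in>F. l' r * a r c') = (\<Sum>r\<in>F. a e c * (l r * a r c'))"
          using F by (intro sum.cong) (auto simp: l'_def)
        then show ?thesis
          using z[OF that] F by (simp add: expand l'_def sum_distrib_left)
      qed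
      then have "l' r = 0"
        using lin_indepD[OF ind, of l' r] r by blast
      with c r F show "l r = 0" by (auto simp: l'_def split: if_splits)
    qed
  next
    assume ind: "lin_indep F C (\<lambda>r c'. a e c * a r c' - a r c * a e c')"
    show "lin_indep (insert e F) C a"
    proof (rule lin_indepI)
      fix l r
      assume z: "\<And>c'. c' \<in> C \<Longrightarrow> (\<Sum>r\<in>insert e F. l r * a r c') = 0" and r: "r \<in> insert e F"
      have z': "(\<Sum>r\<in>F. l r * a r c') = - l e * a e c'" if "c' \<in> C" for c'
        using z[OF that] F by simp
      have F0: "l r = 0" if "r \<in> F" for r
        by (rule lin_indepD[OF ind _ that]) (use c in \<open>simp add: expand z'\<close>)
      with z'[OF c(1)] c(2) have "l e = 0" by simp
      with F0 r show "l r = 0" by blast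
    qed
  qed
qed

text \<open>Division-free Gaussian elimination, summed (as squares) over all choices of the pivot, turns
  independence into the nonvanishing of one function of the parameter.\<close>

lemma ex_discriminant:
  fixes K :: "('z \<Rightarrow> real) \<Rightarrow> bool" and a :: "'z \<Rightarrow> 'r \<Rightarrow> 'c \<Rightarrow> real"
  assumes K: "K (\<lambda>_. 0)" "K (\<lambda>_. 1)" "\<And>f g. K f \<Longrightarrow> K g \<Longrightarrow> K (\<lambda>z. f z + g z)"
      "\<And>f g. K f \<Longrightarrow> K g \<Longrightarrow> K (\<lambda>z. f z - g z)" "\<And>f g. K f \<Longrightarrow> K g \<Longrightarrow> K (\<lambda>z. f z * g z)"
    and "finite F" "finite C" "\<And>r c. r \<in> F \<Longrightarrow> c \<in> C \<Longrightarrow> K (\<lambda>z. a z r c)"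
  shows "\<exists>D. K D \<and> (\<forall>z. D z \<noteq> 0 \<longleftrightarrow> lin_indep F C (a z))"
  using assms(6,8)
proof (induction F arbitrary: a rule: finite_induct)
  case empty
  then show ?case using K(2) by (intro exI[of _ "\<lambda>_. 1"]) (auto simp: lin_indep_def)
next
  case (insert e F)
  have "\<forall>c\<in>C. \<exists>D. K D \<and>
      (\<forall>z. D z \<noteq> 0 \<longleftrightarrow> lin_indep F C (\<lambda>r c'. a z e c * a z r c' - a z r c * a z e c'))"
    using insert.prems by (intro ballI insert.IH K(4,5)) auto
  from bchoice[OF this] obtain D where KD: "\<And>c. c \<in> C \<Longrightarrow> K (D c)"
    and D: "\<And>c z. c \<in> C \<Longrightarrow>
      D c z \<noteq> 0 \<longleftrightarrow> lin_indep F C (\<lambda>r c'. a z e c * a z r c' - a z r c * a z e c')"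
    by blast
  have sumK: "K (\<lambda>z. \<Sum>c\<in>S. g c z)" if "finite S" "\<And>c. c \<in> S \<Longrightarrow> K (g c)" for S :: "'c set" and g
    using that by (induction S rule: finite_induct) (auto intro: K)
  \<comment> \<open>The factor \<open>a z e c\<close> discards the columns whose entry cannot serve
    as a pivot at \<open>z\<close>; there \<open>D c z\<close> carries no information about the
    original rows.\<close>
  let ?D = "\<lambda>z. \<Sum>c\<in>C. (a z e c * D c z) * (a z e c * D c z)"
  have "K ?D"
    using insert.prems by (intro sumK[OF assms(7)] K(5) KD) auto
  moreover have "?D z \<noteq> 0 \<longleftrightarrow> lin_indep (insert e F) C (a z)" for z
  proof -
    have "?D z \<noteq> 0 \<longleftrightarrow> (\<exists>c\<in>C. a z e c \<noteq> 0 \<and> D c z \<noteq> 0)"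
      using assms(7) by (subst sum_nonneg_eq_0_iff) auto
    also have "\<dots> \<longleftrightarrow> (\<exists>c\<in>C. a z e c \<noteq> 0 \<and> lin_indep (insert e F) C (a z))"
      using D lin_indep_eliminate[OF insert.hyps, of _ C "a z"] by blast
    also have "\<dots> \<longleftrightarrow> lin_indep (insert e F) C (a z)"
    proof -
      have "\<exists>c\<in>C. a z e c \<noteq> 0" if ind: "lin_indep (insert e F) C (a z)"
      proof (rule ccontr)
        assume "\<not> ?thesis"
        then have "(\<Sum>r\<in>insert e F. of_bool (r = e) * a z r c) = 0" if "c \<in> C" for c
          using that insert.hyps by (intro sum.neutral) auto
        from lin_indepD[OF ind, of "\<lambda>r. of_bool (r = e)" e, OF this] show False by simp
      qed
      then show ?thesis by blast
    qed
    finally show ?thesis .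
  qed
  ultimately show ?case by blast
qed

lemma ex_orthogonal_projection:
  fixes a :: "'r \<Rightarrow> 'c \<Rightarrow> real"
  assumes "finite F" "finite C"
  shows "\<exists>\<mu>. \<forall>r\<in>F. (\<Sum>c\<in>C. a r c * (w c - (\<Sum>s\<in>F. \<mu> s * a s c))) = 0"
  using assms(1)
proof (induction F arbitrary: w rule: finite_induct)
  case (insert e F)
  obtain \<mu> where \<mu>: "\<And>r. r \<in> F \<Longrightarrow> (\<Sum>c\<in>C. a r c * (w c - (\<Sum>s\<in>F. \<mu> s * a s c))) = 0"
    using insert.IH[of w] by blast
  obtain \<nu> where \<nu>: "\<And>r. r \<in> F \<Longrightarrow> (\<Sum>c\<in>C. a r c * (a e c - (\<Sum>s\<in>F. \<nu> s * a s c))) = 0"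
    using insert.IH[of "a e"] by blast
  \<comment> \<open>Gram-Schmidt: \<open>w'\<close> and \<open>e'\<close> are the parts of
    \<open>w\<close> and of row \<open>e\<close> orthogonal to the earlier rows; subtracting the
    multiple \<open>t\<close> of \<open>e'\<close> makes \<open>w'\<close> orthogonal to
    \<open>e\<close> too. Rows may be dependent, hence the later case that \<open>e'\<close>
    vanishes.\<close>
  define w' where "w' c = w c - (\<Sum>s\<in>F. \<mu> s * a s c)" for c
  define e' where "e' c = a e c - (\<Sum>s\<in>F. \<nu> s * a s c)" for c
  have e: "a e c = e' c + (\<Sum>s\<in>F. \<nu> s * a s c)" for c by (simp add: e'_def)
  have orth: "(\<Sum>c\<in>C. a e c * x c) = (\<Sum>c\<in>C. e' c * x c)"
    if "\<And>r. r \<in> F \<Longrightarrow> (\<Sum>c\<in>C. a r c * x c) = 0" for x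
  proof -
    have "(\<Sum>c\<in>C. (\<Sum>s\<in>F. \<nu> s * a s c) * x c) = (\<Sum>s\<in>F. \<nu> s * (\<Sum>c\<in>C. a s c * x c))"
      by (simp add: sum_distrib_left sum_distrib_right mult.assoc) (rule sum.swap)
    also have "\<dots> = 0" using that by simp
    finally show ?thesis by (simp add: e distrib_right sum.distrib)
  qed
  define t where "t = (\<Sum>c\<in>C. e' c * w' c) / (\<Sum>c\<in>C. e' c * e' c)"
  define \<rho> where "\<rho> s = (if s = e then t else \<mu> s - t * \<nu> s)" for s
  have \<rho>: "w c - (\<Sum>s\<in>insert e F. \<rho> s * a s c) = w' c - t * e' c" for c
  proof -
    have "(\<Sum>s\<in>F. \<rho> s * a s c) = (\<Sum>s\<in>F. (\<mu> s - t * \<nu> s) * a s c)"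
      using insert.hyps by (intro sum.cong) (auto simp: \<rho>_def)
    then show ?thesis using insert.hyps
      by (simp add: w'_def e'_def algebra_simps sum_subtractf sum_distrib_left \<rho>_def)
  qed
  have F0: "(\<Sum>c\<in>C. a r c * (w' c - t * e' c)) = 0" if "r \<in> F" for r
  proof -
    have "(\<Sum>c\<in>C. a r c * (w' c - t * e' c)) = (\<Sum>c\<in>C. a r c * w' c) - t * (\<Sum>c\<in>C. a r c * e' c)"
      by (simp add: algebra_simps sum_subtractf sum_distrib_left)
    then show ?thesis using \<mu>[OF that] \<nu>[OF that] by (simp add: w'_def e'_def)
  qed
  have "(\<Sum>c\<in>C. a e c * (w' c - t * e' c)) = (\<Sum>c\<in>C. e' c * (w' c - t * e' c))"
    by (rule orth) (rule F0)
  also have "\<dots> = (\<Sum>c\<in>C. e' c * w' c) - t * (\<Sum>c\<in>C. e' c * e' c)"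
    by (simp add: algebra_simps sum_subtractf sum_distrib_left)
  also have "\<dots> = 0"
  proof (cases "(\<Sum>c\<in>C. e' c * e' c) = 0")
    case True
    then have "\<forall>c\<in>C. e' c = 0" using assms(2) by (subst (asm) sum_nonneg_eq_0_iff) auto
    then show ?thesis by simp
  qed (simp add: t_def)
  finally show ?case
    using F0 by (intro exI[of _ \<rho>]) (auto simp: \<rho>)
qed simp

text \<open>The part of row \<open>s\<close> orthogonal to the other rows is nonzero by
  independence; divided by its squared length it is dual to \<open>s\<close>. Such vectors will be
  motions that change only one edge length to first order.\<close>

lemma lin_indep_dual:
  assumes "finite F" "finite C" and ind: "lin_indep F C a" and s: "s \<in> F"
  shows "\<exists>b. \<forall>r\<in>F. (\<Sum>c\<in>C. a r c * b c) = of_bool (r = s)"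
proof -
  obtain \<mu> where \<mu>: "\<And>r. r \<in> F - {s} \<Longrightarrow>
      (\<Sum>c\<in>C. a r c * (a s c - (\<Sum>q\<in>F - {s}. \<mu> q * a q c))) = 0"
    using ex_orthogonal_projection[of "F - {s}" C a "a s"] assms by auto
  define b where "b c = a s c - (\<Sum>q\<in>F - {s}. \<mu> q * a q c)" for c
  have sb: "a s c = b c + (\<Sum>q\<in>F - {s}. \<mu> q * a q c)" for c by (simp add: b_def)
  have "(\<Sum>c\<in>C. (\<Sum>q\<in>F - {s}. \<mu> q * a q c) * b c) = (\<Sum>q\<in>F - {s}. \<mu> q * (\<Sum>c\<in>C. a q c * b c))"
    by (simp add: sum_distrib_left sum_distrib_right mult.assoc) (rule sum.swap)
  also have "\<dots> = 0" using \<mu> by (simp add: b_def)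
  finally have ss: "(\<Sum>c\<in>C. a s c * b c) = (\<Sum>c\<in>C. b c * b c)"
    by (simp add: sb distrib_right sum.distrib)
  have "(\<Sum>c\<in>C. b c * b c) \<noteq> 0"
  proof
    assume "(\<Sum>c\<in>C. b c * b c) = 0"
    then have b0: "\<forall>c\<in>C. b c = 0" using assms(2) by (subst (asm) sum_nonneg_eq_0_iff) auto
    define l where "l q = (if q = s then 1 else - \<mu> q)" for q
    have "(\<Sum>q\<in>F. l q * a q c) = 0" if "c \<in> C" for c
    proof -
      have "(\<Sum>q\<in>F. l q * a q c) = l s * a s c + (\<Sum>q\<in>F - {s}. l q * a q c)"
        using assms(1) s by (rule sum.remove)
      also have "(\<Sum>q\<in>F - {s}. l q * a q c) = - (\<Sum>q\<in>F - {s}. \<mu> q * a q c)"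
        by (simp add: sum_negf[symmetric] l_def)
      finally show ?thesis using b0 that by (simp add: l_def b_def)
    qed
    from lin_indepD[OF ind this s] show False by (simp add: l_def)
  qed
  then show ?thesis
    using \<mu> ss by (intro exI[of _ "\<lambda>c. b c / (\<Sum>c\<in>C. b c * b c)"])
      (auto simp: sum_divide_distrib[symmetric] b_def)
qed

text \<open>Pairing a relation with \<open>w\<close> leaves only the coefficient of
  \<open>e\<close>.\<close>

lemma lin_indep_insertI:
  assumes F: "finite F" "e \<notin> F" "lin_indep F C a" and "\<And>f. f \<in> F \<Longrightarrow> (\<Sum>c\<in>C. a f c * w c) = 0"
    and e: "(\<Sum>c\<in>C. a e c * w c) \<noteq> 0"
  shows "lin_indep (insert e F) C a"
proof (rule lin_indepI)
  fix l r
  assume z: "\<And>c. c \<in> C \<Longrightarrow> (\<Sum>r\<in>insert e F. l r * a r c) = 0" and r: "r \<in> insert e F"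
  have "0 = (\<Sum>c\<in>C. (\<Sum>r\<in>insert e F. l r * a r c) * w c)" using z by simp
  also have "\<dots> = (\<Sum>r\<in>insert e F. l r * (\<Sum>c\<in>C. a r c * w c))"
    by (simp only: sum_distrib_left sum_distrib_right mult.assoc) (rule sum.swap)
  also have "\<dots> = l e * (\<Sum>c\<in>C. a e c * w c)" using assms by simp
  finally have le: "l e = 0" using e by simp
  have "l r = 0" if "r \<in> F" for r
    by (rule lin_indepD[OF F(3) _ that]) (use z F le in simp)
  with le r show "l r = 0" by blast
qed

lemma ex_max_lin_indep:
  assumes "finite E"
  obtains F where "F \<subseteq> E" "lin_indep F C a" "\<And>e. e \<in> E \<Longrightarrow> e \<notin> F \<Longrightarrow> \<not> lin_indep (insert e F) C a"
proof -
  let ?A = "{F. F \<subseteq> E \<and> lin_indep F C a}"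
  have "finite ?A" using assms by simp
  moreover have "{} \<in> ?A" by (simp add: lin_indep_def)
  ultimately obtain F where F: "F \<in> ?A" "\<And>G. G \<in> ?A \<Longrightarrow> F \<subseteq> G \<Longrightarrow> G = F"
    using finite_has_maximal[of ?A] by (metis (no_types, lifting) empty_iff)
  show thesis
  proof (rule that[of F])
    show "\<not> lin_indep (insert e F) C a" if "e \<in> E" "e \<notin> F" for e
      using F(1) F(2)[of "insert e F"] that by blast
  qed (use F in auto)
qed


section \<open>Rational polynomial functions and generic points\<close>

definition monom_val :: "('i \<Rightarrow>\<^sub>0 nat) \<Rightarrow> ('i \<Rightarrow> real) \<Rightarrow> real" where
  "monom_val \<mu> z = (\<Prod>i\<in>Poly_Mapping.keys \<mu>. z i ^ Poly_Mapping.lookup \<mu> i)"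

lemma monom_val_superset:
  assumes "finite S" "Poly_Mapping.keys \<mu> \<subseteq> S"
  shows "monom_val \<mu> z = (\<Prod>i\<in>S. z i ^ Poly_Mapping.lookup \<mu> i)"
  unfolding monom_val_def using assms
  by (intro prod.mono_neutral_left) (auto simp: in_keys_iff)

lemma monom_val_add: "monom_val (\<mu> + \<nu>) z = monom_val \<mu> z * monom_val \<nu> z"
proof -
  let ?S = "Poly_Mapping.keys \<mu> \<union> Poly_Mapping.keys \<nu>"
  have "monom_val \<xi> z = (\<Prod>i\<in>?S. z i ^ Poly_Mapping.lookup \<xi> i)" if "Poly_Mapping.keys \<xi> \<subseteq> ?S" for \<xi>
    using that by (intro monom_val_superset) auto
  then show ?thesis
    using Poly_Mapping.keys_add[of \<mu> \<nu>]
    by (simp add: lookup_add power_add prod.distrib)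
qed

lemma poly_eval_superset:
  assumes "finite S" "Poly_Mapping.keys P \<subseteq> S"
  shows "poly_eval P z = (\<Sum>\<mu>\<in>S. of_rat (Poly_Mapping.lookup P \<mu>) * monom_val \<mu> z)"
  unfolding poly_eval_def monom_val_def[symmetric] using assms
  by (intro sum.mono_neutral_left) (auto simp: in_keys_iff)

lemma poly_eval_zero [simp]: "poly_eval 0 z = 0"
  by (simp add: poly_eval_def)

lemma poly_eval_single: "poly_eval (Poly_Mapping.single \<mu> c) z = of_rat c * monom_val \<mu> z"
  by (subst poly_eval_superset[of "{\<mu>}"]) auto

lemma poly_eval_add: "poly_eval (P + Q) z = poly_eval P z + poly_eval Q z"
proof -
  let ?S = "Poly_Mapping.keys P \<union> Poly_Mapping.keys Q"
  have "poly_eval R z = (\<Sum>\<mu>\<in>?S. of_rat (Poly_Mapping.lookup R \<mu>) * monom_val \<mu> z)"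
    if "Poly_Mapping.keys R \<subseteq> ?S" for R
    using that by (intro poly_eval_superset) auto
  then show ?thesis
    using Poly_Mapping.keys_add[of P Q]
    by (simp add: lookup_add of_rat_add algebra_simps sum.distrib)
qed

lemma poly_eval_sum: "poly_eval (\<Sum>x\<in>A. P x) z = (\<Sum>x\<in>A. poly_eval (P x) z)"
  by (induction A rule: infinite_finite_induct) (auto simp: poly_eval_add)

lemma poly_mapping_sum_single:
  "P = (\<Sum>\<mu>\<in>Poly_Mapping.keys P. Poly_Mapping.single \<mu> (Poly_Mapping.lookup P \<mu>))"
  by (rule poly_mapping_eqI) (auto simp: lookup_sum lookup_single when_def in_keys_iff)

lemma poly_eval_mult: "poly_eval (P * Q) z = poly_eval P z * poly_eval Q z"
proof -
  have "P * Q = (\<Sum>\<mu>\<in>Poly_Mapping.keys P. \<Sum>\<nu>\<in>Poly_Mapping.keys Q.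
      Poly_Mapping.single (\<mu> + \<nu>) (Poly_Mapping.lookup P \<mu> * Poly_Mapping.lookup Q \<nu>))"
    by (subst (1) poly_mapping_sum_single[of P], subst (1) poly_mapping_sum_single[of Q])
      (simp add: sum_product mult_single)
  then have "poly_eval (P * Q) z = (\<Sum>\<mu>\<in>Poly_Mapping.keys P. \<Sum>\<nu>\<in>Poly_Mapping.keys Q.
      (of_rat (Poly_Mapping.lookup P \<mu>) * monom_val \<mu> z) *
      (of_rat (Poly_Mapping.lookup Q \<nu>) * monom_val \<nu> z))"
    by (simp add: poly_eval_sum poly_eval_single of_rat_mult monom_val_add algebra_simps)
  also have "\<dots> = poly_eval P z * poly_eval Q z"
    by (simp add: sum_product poly_eval_def monom_val_def)
  finally show ?thesis .
qed

definition ratpoly :: "'i set \<Rightarrow> (('i \<Rightarrow> real) \<Rightarrow> real) \<Rightarrow> bool" where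
  "ratpoly I f \<longleftrightarrow>
     (\<exists>P. (\<forall>\<mu>\<in>Poly_Mapping.keys P. Poly_Mapping.keys \<mu> \<subseteq> I) \<and> (\<forall>z. f z = poly_eval P z))"

lemma ratpoly_Rats: "c \<in> \<rat> \<Longrightarrow> ratpoly I (\<lambda>_. c)"
proof (elim Rats_cases)
  fix r assume "c = of_rat r"
  then show ?thesis unfolding ratpoly_def
    by (intro exI[of _ "Poly_Mapping.single 0 r"]) (auto simp: poly_eval_single monom_val_def)
qed

lemma ratpoly_0: "ratpoly I (\<lambda>_. 0)" and ratpoly_1: "ratpoly I (\<lambda>_. 1)"
  by (simp_all add: ratpoly_Rats)

lemma ratpoly_of_bool: "ratpoly I (\<lambda>_. of_bool b)"
  by (simp add: ratpoly_Rats)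

lemma ratpoly_var: "i \<in> I \<Longrightarrow> ratpoly I (\<lambda>z. z i)"
  unfolding ratpoly_def
  by (intro exI[of _ "Poly_Mapping.single (Poly_Mapping.single i 1) 1"])
    (auto simp: poly_eval_single monom_val_def)

lemma ratpoly_add:
  assumes "ratpoly I f" "ratpoly I g"
  shows "ratpoly I (\<lambda>z. f z + g z)"
proof -
  obtain P Q where "\<forall>\<mu>\<in>Poly_Mapping.keys P. Poly_Mapping.keys \<mu> \<subseteq> I" "\<forall>z. f z = poly_eval P z"
    "\<forall>\<mu>\<in>Poly_Mapping.keys Q. Poly_Mapping.keys \<mu> \<subseteq> I" "\<forall>z. g z = poly_eval Q z"
    using assms unfolding ratpoly_def by auto
  then show ?thesis unfolding ratpoly_def
    using Poly_Mapping.keys_add[of P Q]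
    by (intro exI[of _ "P + Q"] conjI ballI) (blast, simp add: poly_eval_add)
qed

lemma ratpoly_mult:
  assumes "ratpoly I f" "ratpoly I g"
  shows "ratpoly I (\<lambda>z. f z * g z)"
proof -
  obtain P Q where *: "\<forall>\<mu>\<in>Poly_Mapping.keys P. Poly_Mapping.keys \<mu> \<subseteq> I" "\<forall>z. f z = poly_eval P z"
    "\<forall>\<mu>\<in>Poly_Mapping.keys Q. Poly_Mapping.keys \<mu> \<subseteq> I" "\<forall>z. g z = poly_eval Q z"
    using assms unfolding ratpoly_def by auto
  have "Poly_Mapping.keys \<xi> \<subseteq> I" if \<xi>: "\<xi> \<in> Poly_Mapping.keys (P * Q)" for \<xi>
  proof -
    obtain \<mu> \<nu> where "\<xi> = \<mu> + \<nu>" "\<mu> \<in> Poly_Mapping.keys P" "\<nu> \<in> Poly_Mapping.keys Q"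
      using \<xi> Poly_Mapping.keys_mult[of P Q] by blast
    with * show ?thesis using Poly_Mapping.keys_add[of \<mu> \<nu>] by blast
  qed
  with * show ?thesis unfolding ratpoly_def by (intro exI[of _ "P * Q"]) (auto simp: poly_eval_mult)
qed

lemma ratpoly_diff:
  assumes "ratpoly I f" "ratpoly I g"
  shows "ratpoly I (\<lambda>z. f z - g z)"
proof -
  have "ratpoly I (\<lambda>z. f z + (-1) * g z)"
    using assms by (intro ratpoly_add ratpoly_mult ratpoly_Rats) auto
  then show ?thesis by simp
qed

lemmas ratpoly_intros = ratpoly_0 ratpoly_1 ratpoly_of_bool ratpoly_var ratpoly_add ratpoly_mult ratpoly_diff

lemma ratpoly_generic_zero:
  assumes "alg_independent I z" "ratpoly I f" "f z = 0"
  shows "f z' = 0"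
proof -
  obtain P where P: "\<forall>\<mu>\<in>Poly_Mapping.keys P. Poly_Mapping.keys \<mu> \<subseteq> I" "\<forall>z. f z = poly_eval P z"
    using assms unfolding ratpoly_def by auto
  with assms have "P = 0" unfolding alg_independent_def by metis
  with P show ?thesis by simp
qed

lemma ratpoly_discriminant:
  assumes "finite F" "finite C" "\<And>r c. r \<in> F \<Longrightarrow> c \<in> C \<Longrightarrow> ratpoly I (\<lambda>z. a z r c)"
  shows "\<exists>D. ratpoly I D \<and> (\<forall>z. D z \<noteq> 0 \<longleftrightarrow> lin_indep F C (a z))"
  by (rule ex_discriminant[of "ratpoly I"]) (intro ratpoly_intros assms; assumption)+

text \<open>A discriminant that is nonzero at \<open>z'\<close> comes from a nonzero rational
  polynomial, so it cannot vanish at an algebraically independent point. Hence one good placement,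
  however special, is enough.\<close>

lemma lin_indep_generic:
  assumes "alg_independent I z" "finite F" "finite C"
    "\<And>r c. r \<in> F \<Longrightarrow> c \<in> C \<Longrightarrow> ratpoly I (\<lambda>z. a z r c)" "lin_indep F C (a z')"
  shows "lin_indep F C (a z)"
proof -
  obtain D where D: "ratpoly I D" "\<And>z. D z \<noteq> 0 \<longleftrightarrow> lin_indep F C (a z)"
    using ratpoly_discriminant[of F C I a] assms by blast
  have "D z \<noteq> 0"
    using ratpoly_generic_zero[OF assms(1) D(1), of z'] D(2)[of z'] assms(5) by blast
  then show ?thesis by (simp add: D(2))
qed

text \<open>The discriminant again, now in the ring of continuous functions.\<close>

lemma lin_indep_open:
  fixes a :: "'t::topological_space \<Rightarrow> 'r \<Rightarrow> 'c \<Rightarrow> real"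
  assumes "finite F" "finite C" "\<And>r c. r \<in> F \<Longrightarrow> c \<in> C \<Longrightarrow> continuous_on T (\<lambda>t. a t r c)"
    and "lin_indep F C (a t)" "t \<in> T"
  shows "\<forall>\<^sub>F s in at t within T. lin_indep F C (a s)"
proof -
  have "\<exists>D :: 't \<Rightarrow> real. continuous_on T D \<and> (\<forall>z. D z \<noteq> 0 \<longleftrightarrow> lin_indep F C (a z))"
    by (rule ex_discriminant[where K = "continuous_on T"]) (auto intro!: continuous_intros assms)
  then obtain D :: "'t \<Rightarrow> real" where D: "continuous_on T D" "\<And>z. D z \<noteq> 0 \<longleftrightarrow> lin_indep F C (a z)" by blast
  have "(D \<longlongrightarrow> D t) (at t within T)"
    using D(1) assms(5) by (simp add: continuous_on_def)
  moreover have "D t \<noteq> 0" using D(2) assms(4) by blast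
  ultimately have "\<forall>\<^sub>F s in at t within T. D s \<noteq> 0"
    by (rule tendsto_imp_eventually_ne)
  then show ?thesis by (simp add: D(2))
qed

section \<open>Existence of generic points\<close>

lemma countable_poly_mapping_finite:
  assumes "finite I"
  shows "countable {f :: 'a \<Rightarrow>\<^sub>0 'b::{countable, zero}. Poly_Mapping.keys f \<subseteq> I}"
proof (rule countable_image_inj_on)
  let ?A = "{f :: 'a \<Rightarrow>\<^sub>0 'b. Poly_Mapping.keys f \<subseteq> I}"
  show "countable ((\<lambda>f. restrict (Poly_Mapping.lookup f) I) ` ?A)"
    by (rule countable_subset[OF _ countable_PiE[OF assms, of "\<lambda>_. UNIV :: 'b set"]]) auto
  show "inj_on (\<lambda>f. restrict (Poly_Mapping.lookup f) I) ?A"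
  proof (rule inj_onI)
    fix f g :: "'a \<Rightarrow>\<^sub>0 'b"
    assume f: "f \<in> ?A" and g: "g \<in> ?A"
      and eq: "restrict (Poly_Mapping.lookup f) I = restrict (Poly_Mapping.lookup g) I"
    show "f = g"
    proof (rule poly_mapping_eqI)
      fix i
      show "Poly_Mapping.lookup f i = Poly_Mapping.lookup g i"
      proof (cases "i \<in> I")
        case True
        then show ?thesis using fun_cong[OF eq, of i] by simp
      next
        case False
        then show ?thesis using f g by (metis (mono_tags, lifting) in_keys_iff mem_Collect_eq subsetD)
      qed
    qed
  qed
qed

lemma countable_rational_polynomials:
  assumes "finite I"
  shows "countable {P :: ('i \<Rightarrow>\<^sub>0 nat) \<Rightarrow>\<^sub>0 rat. \<forall>\<mu>\<in>Poly_Mapping.keys P. Poly_Mapping.keys \<mu> \<subseteq> I}"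
proof -
  let ?M = "{\<mu> :: 'i \<Rightarrow>\<^sub>0 nat. Poly_Mapping.keys \<mu> \<subseteq> I}"
  have "countable ?M" by (rule countable_poly_mapping_finite[OF assms])
  then have "countable (\<Union>K\<in>{K. finite K \<and> K \<subseteq> ?M}.
      {P :: ('i \<Rightarrow>\<^sub>0 nat) \<Rightarrow>\<^sub>0 rat. Poly_Mapping.keys P \<subseteq> K})"
    by (intro countable_UN countable_Collect_finite_subset) (auto intro: countable_poly_mapping_finite)
  then show ?thesis
    by (rule countable_subset[rotated]) (use finite_keys in blast)
qed

text \<open>With the other coordinates fixed at \<open>z\<close>, \<open>P\<close> becomes a
  polynomial in one variable whose coefficients are rational polynomials evaluated at
  \<open>z\<close>. One of these is not the zero polynomial, so its value at the algebraically
  independent \<open>z\<close> is nonzero.\<close>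

lemma finite_poly_eval_roots:
  assumes z: "alg_independent I z" and i: "i \<notin> I" and "P \<noteq> 0"
    and P: "\<forall>\<mu>\<in>Poly_Mapping.keys P. Poly_Mapping.keys \<mu> \<subseteq> insert i I"
  shows "finite {x. poly_eval P (z(i := x)) = 0}"
proof -
  let ?c = "\<lambda>\<mu>. Poly_Mapping.update i 0 \<mu>"
  define q where "q = (\<Sum>\<mu>\<in>Poly_Mapping.keys P.
    Polynomial.monom (of_rat (Poly_Mapping.lookup P \<mu>) * monom_val (?c \<mu>) z) (Poly_Mapping.lookup \<mu> i))"
  have keys_c: "Poly_Mapping.keys (?c \<mu>) = Poly_Mapping.keys \<mu> - {i}" for \<mu> :: "'a \<Rightarrow>\<^sub>0 nat"
    by (simp add: keys_update)
  have split: "monom_val \<mu> (z(i := x)) = monom_val (?c \<mu>) z * x ^ Poly_Mapping.lookup \<mu> i" for \<mu> x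
  proof -
    have "monom_val \<mu> (z(i := x)) =
        (\<Prod>j\<in>insert i (Poly_Mapping.keys \<mu>). (z(i := x)) j ^ Poly_Mapping.lookup \<mu> j)"
      by (rule monom_val_superset) auto
    also have "\<dots> = x ^ Poly_Mapping.lookup \<mu> i *
        (\<Prod>j\<in>Poly_Mapping.keys \<mu> - {i}. (z(i := x)) j ^ Poly_Mapping.lookup \<mu> j)"
      by (subst prod.insert_remove) auto
    also have "(\<Prod>j\<in>Poly_Mapping.keys \<mu> - {i}. (z(i := x)) j ^ Poly_Mapping.lookup \<mu> j) = monom_val (?c \<mu>) z"
      unfolding monom_val_def keys_c by (intro prod.cong) (auto simp: lookup_update)
    finally show ?thesis by (simp only: mult.commute)
  qed
  have q: "poly q x = poly_eval P (z(i := x))" for x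
    by (simp add: q_def poly_sum poly_monom poly_eval_def monom_val_def[symmetric] split mult.assoc
        del: fun_upd_apply)
  obtain \<mu>0 where \<mu>0: "\<mu>0 \<in> Poly_Mapping.keys P" using \<open>P \<noteq> 0\<close> by fastforce
  let ?k = "Poly_Mapping.lookup \<mu>0 i"
  let ?S = "{\<mu>\<in>Poly_Mapping.keys P. Poly_Mapping.lookup \<mu> i = ?k}"
  \<comment> \<open>\<open>R\<close> gives the coefficient of the power \<open>?k\<close>. Erasing
    the exponent of \<open>i\<close> is injective on monomials sharing that exponent, so no terms
    merge.\<close>
  define R where "R = (\<Sum>\<mu>\<in>?S. Poly_Mapping.single (?c \<mu>) (Poly_Mapping.lookup P \<mu>))"
  have "poly.coeff q ?k = (\<Sum>\<mu>\<in>?S. of_rat (Poly_Mapping.lookup P \<mu>) * monom_val (?c \<mu>) z)"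
    by (simp add: q_def coeff_sum coeff_monom sum.If_cases Int_def)
  also have "\<dots> = poly_eval R z"
    by (simp add: R_def poly_eval_sum poly_eval_single)
  finally have coeff: "poly.coeff q ?k = poly_eval R z" .
  have inj: "\<mu> = \<mu>0" if "Poly_Mapping.lookup \<mu> i = ?k" "?c \<mu> = ?c \<mu>0" for \<mu>
  proof (rule poly_mapping_eqI)
    fix j
    show "Poly_Mapping.lookup \<mu> j = Poly_Mapping.lookup \<mu>0 j"
      using that(1) arg_cong[OF that(2), of "\<lambda>\<nu>. Poly_Mapping.lookup \<nu> j"]
      by (cases "i = j") (simp_all add: lookup_update)
  qed
  have "Poly_Mapping.lookup R (?c \<mu>0) = (\<Sum>\<mu>\<in>?S. if \<mu> = \<mu>0 then Poly_Mapping.lookup P \<mu>0 else 0)"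
    unfolding R_def lookup_sum by (intro sum.cong) (auto simp: lookup_single when_def dest: inj)
  also have "\<dots> = Poly_Mapping.lookup P \<mu>0" using \<mu>0 by simp
  finally have "R \<noteq> 0" using \<mu>0 by (auto simp: in_keys_iff)
  moreover have "\<forall>\<mu>\<in>Poly_Mapping.keys R. Poly_Mapping.keys \<mu> \<subseteq> I"
  proof
    fix \<mu> assume "\<mu> \<in> Poly_Mapping.keys R"
    then have "\<mu> \<in> (\<Union>\<nu>\<in>?S. Poly_Mapping.keys (Poly_Mapping.single (?c \<nu>) (Poly_Mapping.lookup P \<nu>)))"
      unfolding R_def using Poly_Mapping.keys_sum by (rule subsetD[rotated])
    then obtain \<nu> where "\<nu> \<in> ?S" "\<mu> = ?c \<nu>" by (auto split: if_splits)
    then show "Poly_Mapping.keys \<mu> \<subseteq> I" using P keys_c by auto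
  qed
  ultimately have "poly_eval R z \<noteq> 0" using z unfolding alg_independent_def by blast
  then have "q \<noteq> 0" using coeff by auto
  then show ?thesis using poly_roots_finite[of q] by (simp add: q)
qed

text \<open>Coordinates are adjoined one at a time: countably many nonzero rational polynomials
  exclude finitely many reals each, so some real is left.\<close>

lemma ex_alg_independent:
  fixes I :: "'i set"
  assumes "finite I"
  shows "\<exists>z. alg_independent I z"
  using assms
proof (induction I rule: finite_induct)
  case empty
  have "alg_independent {} (\<lambda>_ :: 'i. 0)"
    unfolding alg_independent_def
  proof (intro allI impI)
    fix P :: "('i \<Rightarrow>\<^sub>0 nat) \<Rightarrow>\<^sub>0 rat"
    assume P: "(\<forall>\<mu>\<in>Poly_Mapping.keys P. Poly_Mapping.keys \<mu> \<subseteq> {}) \<and> poly_eval P (\<lambda>_. 0) = 0"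
    then have keys: "Poly_Mapping.keys P \<subseteq> {0}" by auto
    then have "poly_eval P (\<lambda>_. 0) = of_rat (Poly_Mapping.lookup P 0)"
      by (subst poly_eval_superset[of "{0}"]) (auto simp: monom_val_def)
    with P have "Poly_Mapping.lookup P 0 = 0" by simp
    then have "0 \<notin> Poly_Mapping.keys P" by (simp add: in_keys_iff)
    with keys have "Poly_Mapping.keys P = {}" by blast
    then show "P = 0" by simp
  qed
  then show ?case by blast
next
  case (insert i I)
  then obtain z where z: "alg_independent I z" by blast
  let ?\<P> = "{P :: ('i \<Rightarrow>\<^sub>0 nat) \<Rightarrow>\<^sub>0 rat. \<forall>\<mu>\<in>Poly_Mapping.keys P. Poly_Mapping.keys \<mu> \<subseteq> insert i I}"
  have "countable (\<Union>P\<in>?\<P> - {0}. {x. poly_eval P (z(i := x)) = 0})"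
    by (intro countable_UN countable_Diff countable_rational_polynomials countable_finite
        finite_poly_eval_roots[OF z]) (use insert in auto)
  then have "(\<Union>P\<in>?\<P> - {0}. {x. poly_eval P (z(i := x)) = 0}) \<noteq> UNIV"
    using uncountable_UNIV_real by metis
  then obtain x where "x \<notin> (\<Union>P\<in>?\<P> - {0}. {x. poly_eval P (z(i := x)) = 0})" by blast
  then have "alg_independent (insert i I) (z(i := x))"
    unfolding alg_independent_def by blast
  then show ?case by blast
qed

lemma ex_generic:
  assumes "finite S"
  shows "\<exists>p :: 'i \<Rightarrow> real ^ 'd::finite. generic S p"
proof -
  obtain z :: "'i \<times> 'd \<Rightarrow> real" where "alg_independent (S \<times> UNIV) z"
    using ex_alg_independent[of "S \<times> (UNIV :: 'd set)"] assms by auto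
  then have "generic S (\<lambda>v. \<chi> k. z (v, k))" by (simp add: generic_def)
  then show ?thesis by blast
qed

lemma alg_independent_mono: "alg_independent I z \<Longrightarrow> J \<subseteq> I \<Longrightarrow> alg_independent J z"
  unfolding alg_independent_def by (meson subset_trans)

lemma generic_mono: "generic S p \<Longrightarrow> T \<subseteq> S \<Longrightarrow> generic T p"
  unfolding generic_def by (erule alg_independent_mono) auto


section \<open>Infinitesimal rigidity at generic points\<close>

text \<open>The library has completeness of this space only for metric index types, which excludes \<open>nat\<close>.\<close>

lemma complete_bcontfun_nat: "complete (UNIV :: (nat \<Rightarrow>\<^sub>C real) set)"
  unfolding complete_def
proof (intro allI impI)
  fix f :: "nat \<Rightarrow> nat \<Rightarrow>\<^sub>C real"
  assume "(\<forall>n. f n \<in> UNIV) \<and> Cauchy f"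
  then obtain g where "uniform_limit UNIV (\<lambda>n. apply_bcontfun (f n)) g sequentially"
    using uniformly_convergent_eq_cauchy[of "\<lambda>_. True" "\<lambda>n. apply_bcontfun (f n)"]
    unfolding Cauchy_def uniform_limit_sequentially_iff
    by (metis dist_fun_lt_imp_dist_val_lt)
  from uniform_limit_bcontfunE[OF this sequentially_bot]
  obtain l where "f \<longlonglongrightarrow> l" by metis
  then show "\<exists>l\<in>UNIV. f \<longlonglongrightarrow> l" by blast
qed

text \<open>An inverse function theorem for a second-order perturbation of the identity:
  \<open>Q\<close> has Lipschitz constant at most \<open>C * r\<close> on the cube of radius
  \<open>r\<close>, so the equation is solved by a contraction. It will supply curves along which
  edge lengths vary as prescribed.\<close>

lemma quadratic_curve:
  fixes n :: nat and Q :: "(nat \<Rightarrow> real) \<Rightarrow> nat \<Rightarrow> real" and b :: "nat \<Rightarrow> real"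
  assumes C: "0 \<le> C" and Q: "\<And>y y' r s i. i < n \<Longrightarrow> (\<And>j. j < n \<Longrightarrow> \<bar>y j\<bar> \<le> r) \<Longrightarrow>
      (\<And>j. j < n \<Longrightarrow> \<bar>y' j\<bar> \<le> r) \<Longrightarrow> (\<And>j. j < n \<Longrightarrow> \<bar>y j - y' j\<bar> \<le> s) \<Longrightarrow>
      \<bar>Q y i - Q y' i\<bar> \<le> C * r * s"
    and Q0: "\<And>i. i < n \<Longrightarrow> Q (\<lambda>_. 0) i = 0"
  shows "\<exists>\<epsilon>>0. \<exists>Y :: real \<Rightarrow> nat \<Rightarrow> real. \<forall>i<n. continuous_on {0..1} (\<lambda>t. Y t i) \<and> Y 0 i = 0 \<and>
    (\<forall>t\<in>{0..1}. Y t i + Q (Y t) i = t * \<epsilon> * b i)"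
proof -
  \<comment> \<open>The radius makes \<open>Q\<close> contract by 1/2, and \<open>\<epsilon>\<close>
    bounds the right-hand side by \<open>r / 2\<close>, so that the ball of radius \<open>r\<close>
    is mapped into itself. The summands 1 here and in \<open>B\<close> keep the denominators
    positive.\<close>
  define r where "r = 1 / (2 * (C + 1))"
  have r: "r > 0" and Cr: "C * r \<le> 1 / 2" using C by (auto simp: r_def field_simps)
  define B where "B = 1 + (\<Sum>i<n. \<bar>b i\<bar>)"
  have B: "B > 0" by (simp add: B_def add_pos_nonneg sum_nonneg)
  have bB: "\<bar>b i\<bar> \<le> B" if "i < n" for i
    using member_le_sum[of i "{..<n}" "\<lambda>i. \<bar>b i\<bar>"] that by (simp add: B_def)
  define \<epsilon> where "\<epsilon> = r / (2 * B)"
  have \<epsilon>: "\<epsilon> > 0" and \<epsilon>B: "\<epsilon> * B = r / 2" using r B by (auto simp: \<epsilon>_def)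
  have tb: "\<bar>(t - s) * \<epsilon> * b i\<bar> \<le> \<bar>t - s\<bar> * (r / 2)" if "i < n" for t s i
  proof -
    have "\<bar>(t - s) * \<epsilon> * b i\<bar> = \<bar>t - s\<bar> * (\<epsilon> * \<bar>b i\<bar>)" using \<epsilon> by (simp add: abs_mult)
    also have "\<dots> \<le> \<bar>t - s\<bar> * (\<epsilon> * B)" using bB[OF that] \<epsilon> by (intro mult_left_mono) auto
    finally show ?thesis by (simp add: \<epsilon>B)
  qed
  \<comment> \<open>The dimension \<open>n\<close> is a term rather than a type, so vectors are
    represented by bounded sequences with the supremum norm; \<open>\<Phi>\<close> puts zeros from
    index \<open>n\<close> on.\<close>
  define \<Phi> :: "real \<Rightarrow> (nat \<Rightarrow>\<^sub>C real) \<Rightarrow> nat \<Rightarrow>\<^sub>C real" where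
    "\<Phi> t y = Bcontfun (\<lambda>i. if i < n then t * \<epsilon> * b i - Q (apply_bcontfun y) i else 0)" for t y
  have \<Phi>: "apply_bcontfun (\<Phi> t y) i = (if i < n then t * \<epsilon> * b i - Q (apply_bcontfun y) i else 0)" for t y i
  proof -
    have "(\<lambda>i. if i < n then t * \<epsilon> * b i - Q (apply_bcontfun y) i else 0) \<in> bcontfun"
    proof (rule bcontfun_normI)
      show "norm (if i < n then t * \<epsilon> * b i - Q (apply_bcontfun y) i else 0)
          \<le> (\<Sum>i<n. \<bar>t * \<epsilon> * b i - Q (apply_bcontfun y) i\<bar>)" for i
        using member_le_sum[of i "{..<n}" "\<lambda>i. \<bar>t * \<epsilon> * b i - Q (apply_bcontfun y) i\<bar>"]
        by (auto intro: sum_nonneg)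
    qed simp
    then show ?thesis by (simp add: \<Phi>_def Bcontfun_inverse)
  qed
  let ?S = "cball (0 :: nat \<Rightarrow>\<^sub>C real) r"
  have S: "\<bar>apply_bcontfun y i\<bar> \<le> r" if "y \<in> ?S" for y i
    using norm_bounded[of y i] that by simp
  have Qdist: "\<bar>Q (apply_bcontfun y) i - Q (apply_bcontfun y') i\<bar> \<le> 1 / 2 * dist y y'"
    if "y \<in> ?S" "y' \<in> ?S" "i < n" for y y' i
  proof -
    have "\<bar>Q (apply_bcontfun y) i - Q (apply_bcontfun y') i\<bar> \<le> C * r * dist y y'"
      using S that dist_bounded[of y _ y'] by (intro Q) (auto simp: dist_real_def)
    also have "\<dots> \<le> 1 / 2 * dist y y'" using Cr by (rule mult_right_mono) simp
    finally show ?thesis .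
  qed
  have zeroS: "0 \<in> ?S" using r by simp
  have app0: "apply_bcontfun (0 :: nat \<Rightarrow>\<^sub>C real) = (\<lambda>_. 0)" by (simp add: zero_bcontfun.rep_eq)
  have \<Phi>S: "\<Phi> t y \<in> ?S" if t: "t \<in> {0..1}" and y: "y \<in> ?S" for t y
  proof -
    have "norm (\<Phi> t y) \<le> r"
    proof (rule norm_bound)
      fix i
      show "norm (apply_bcontfun (\<Phi> t y) i) \<le> r"
      proof (cases "i < n")
        case True
        have "\<bar>Q (apply_bcontfun y) i\<bar> \<le> 1 / 2 * r"
          using Qdist[OF y zeroS True] Q0[OF True] y by (simp add: app0)
        moreover have "\<bar>t * \<epsilon> * b i\<bar> \<le> r / 2"
        proof -
          have "\<bar>t\<bar> * (r / 2) \<le> 1 * (r / 2)" using t r by (intro mult_right_mono) auto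
          with tb[OF True, of t 0] show ?thesis by simp
        qed
        ultimately show ?thesis using True by (simp add: \<Phi>)
      qed (use r in \<open>simp add: \<Phi>\<close>)
    qed
    then show ?thesis by simp
  qed
  have contr: "dist (\<Phi> t y) (\<Phi> s y') \<le> \<bar>t - s\<bar> * (r / 2) + 1 / 2 * dist y y'"
    if "y \<in> ?S" "y' \<in> ?S" for t s y y'
  proof (rule dist_bound)
    fix i
    show "dist (apply_bcontfun (\<Phi> t y) i) (apply_bcontfun (\<Phi> s y') i) \<le> \<bar>t - s\<bar> * (r / 2) + 1 / 2 * dist y y'"
    proof (cases "i < n")
      case True
      have "apply_bcontfun (\<Phi> t y) i - apply_bcontfun (\<Phi> s y') i
          = (t - s) * \<epsilon> * b i - (Q (apply_bcontfun y) i - Q (apply_bcontfun y') i)"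
        using True by (simp add: \<Phi> algebra_simps)
      then show ?thesis
        using tb[OF True, of t s] Qdist[OF that True] unfolding dist_real_def by linarith
    qed (use r in \<open>simp add: \<Phi>\<close>)
  qed
  have fix_ex: "\<exists>!y\<in>?S. \<Phi> t y = y" if "t \<in> {0..1}" for t
  proof (rule Banach_fix[of _ "1 / 2"])
    show "dist (\<Phi> t x) (\<Phi> t y) \<le> 1 / 2 * dist x y" if "x \<in> ?S" "y \<in> ?S" for x y
      using contr[OF that, of t t] by simp
  qed (use zeroS \<Phi>S that in \<open>auto intro: complete_closed_subset[OF _ _ complete_bcontfun_nat]\<close>)
  then have "\<exists>y. y \<in> ?S \<and> \<Phi> t y = y" if "t \<in> {0..1}" for t using that by blast
  then obtain y where yS: "\<And>t. t \<in> {0..1} \<Longrightarrow> y t \<in> ?S" and y: "\<And>t. t \<in> {0..1} \<Longrightarrow> \<Phi> t (y t) = y t"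
    by metis
  \<comment> \<open>The distance of the two fixed points occurs on both sides of
    \<open>contr\<close>; absorbing half of it leaves a Lipschitz bound in the time.\<close>
  have lip: "dist (y t) (y s) \<le> r * dist t s" if "t \<in> {0..1}" "s \<in> {0..1}" for t s
    using contr[of "y t" "y s" t s] yS that y by (simp add: dist_real_def mult.commute)
  have t0: "(0::real) \<in> {0..1}" by simp
  have "\<Phi> 0 0 = 0"
    by (rule bcontfun_eqI) (simp add: \<Phi> app0 Q0)
  then have y0: "y 0 = 0" using fix_ex[OF t0] yS[OF t0] y[OF t0] zeroS by blast
  have "continuous_on {0..1} (\<lambda>t. apply_bcontfun (y t) i)" for i
  proof (rule continuous_onI)
    fix t e :: real assume t: "t \<in> {0..1}" and e: "e > 0"
    have "dist (apply_bcontfun (y s) i) (apply_bcontfun (y t) i) \<le> e"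
      if "s \<in> {0..1}" "dist s t < e / r" for s
    proof -
      have "dist (apply_bcontfun (y s) i) (apply_bcontfun (y t) i) \<le> r * dist s t"
        using dist_bounded[of "y s" i "y t"] lip[OF that(1) t] by linarith
      also have "\<dots> \<le> e" using that(2) r by (simp add: field_simps)
      finally show ?thesis .
    qed
    then show "\<exists>d>0. \<forall>x'\<in>{0..1}. dist x' t < d \<longrightarrow>
        dist (apply_bcontfun (y x') i) (apply_bcontfun (y t) i) \<le> e"
      using e r by (intro exI[of _ "e / r"]) auto
  qed
  moreover have "apply_bcontfun (y 0) i = 0" for i by (simp add: y0 app0)
  moreover have "apply_bcontfun (y t) i + Q (apply_bcontfun (y t)) i = t * \<epsilon> * b i"
    if "i < n" "t \<in> {0..1}" for i t
    using \<Phi>[of t "y t" i] that by (simp add: y)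
  ultimately show ?thesis
    using \<epsilon> by (intro exI[of _ \<epsilon>] conjI exI[of _ "\<lambda>t. apply_bcontfun (y t)"]) auto
qed

section \<open>Placements, rigidity matrices and infinitesimal rigidity\<close>

definition coords :: "('v \<Rightarrow> real ^ 'd) \<Rightarrow> 'v \<times> 'd \<Rightarrow> real" where
  "coords p = (\<lambda>(v, k). p v $ k)"

definition conf :: "('v \<times> 'd::finite \<Rightarrow> real) \<Rightarrow> 'v \<Rightarrow> real ^ 'd" where
  "conf z v = (\<chi> k. z (v, k))"

lemma conf_coords [simp]: "conf (coords p) = p"
  by (auto simp: conf_def coords_def)

lemma conf_nth [simp]: "conf z v $ k = z (v, k)"
  by (simp add: conf_def)

lemma coords_apply [simp]: "coords p (v, k) = p v $ k"
  by (simp add: coords_def)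

lemma generic_iff_coords: "generic S p \<longleftrightarrow> alg_independent (S \<times> UNIV) (coords p)"
  by (simp add: generic_def coords_def)

text \<open>The row of a rigidity matrix belonging to the edge \<open>e\<close>, with \<open>n\<close> in place of the difference of
  the positions of its endpoints.\<close>

definition dir_row :: "real ^ 'd \<Rightarrow> 'v \<times> 'v \<Rightarrow> 'v \<times> 'd \<Rightarrow> real" where
  "dir_row n e c = (of_bool (fst c = fst e) - of_bool (fst c = snd e)) * n $ snd c"

lemma sum_dir_row:
  fixes w :: "'v \<times> 'd::finite \<Rightarrow> real"
  assumes "finite V" "e \<in> V \<times> V"
  shows "(\<Sum>c\<in>V \<times> UNIV. dir_row n e c * w c) = n \<bullet> (conf w (fst e) - conf w (snd e))"
proof -
  have "(\<Sum>c\<in>V \<times> UNIV. dir_row n e c * w c)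
      = (\<Sum>x\<in>V. \<Sum>k\<in>UNIV. dir_row n e (x, k) * w (x, k))"
    by (simp add: sum.cartesian_product)
  also have "\<dots> = (\<Sum>x\<in>V. of_bool (x = fst e) * (n \<bullet> conf w x)) - (\<Sum>x\<in>V. of_bool (x = snd e) * (n \<bullet> conf w x))"
    unfolding sum_subtractf[symmetric]
    by (intro sum.cong) (auto simp: dir_row_def inner_vec_def sum_negf)
  also have "\<dots> = n \<bullet> conf w (fst e) - n \<bullet> conf w (snd e)"
    using assms by (auto simp: if_distrib[of "\<lambda>x. x * _"] of_bool_def cong: if_cong)
  finally show ?thesis by (simp add: inner_diff_right)
qed

definition rig_row :: "('v \<Rightarrow> real ^ 'd) \<Rightarrow> 'v \<times> 'v \<Rightarrow> 'v \<times> 'd \<Rightarrow> real" where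
  "rig_row p e = dir_row (p (fst e) - p (snd e)) e"

lemma sum_rig_row:
  fixes w :: "'v \<times> 'd::finite \<Rightarrow> real"
  assumes "finite V" "e \<in> V \<times> V"
  shows "(\<Sum>c\<in>V \<times> UNIV. rig_row p e c * w c) = (p (fst e) - p (snd e)) \<bullet> (conf w (fst e) - conf w (snd e))"
  unfolding rig_row_def by (rule sum_dir_row[OF assms])

lemma ratpoly_rig_row:
  "e \<in> V \<times> V \<Longrightarrow> ratpoly (V \<times> UNIV) (\<lambda>z :: 'v \<times> 'd::finite \<Rightarrow> real. rig_row (conf z) e c)"
  by (cases e) (auto simp: rig_row_def dir_row_def intro!: ratpoly_intros)

text \<open>Comparing the edges with all pairs, instead of counting dimensions of motions, treats
  vertex sets of every size alike.\<close>

definition inf_rigid :: "'v set \<Rightarrow> ('v \<times> 'v) set \<Rightarrow> ('v \<Rightarrow> real ^ 'd::finite) \<Rightarrow> bool" where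
  "inf_rigid V E p \<longleftrightarrow> (\<forall>w. (\<forall>(u, v)\<in>E. (p u - p v) \<bullet> (w u - w v) = 0) \<longrightarrow>
     (\<forall>u\<in>V. \<forall>v\<in>V. (p u - p v) \<bullet> (w u - w v) = 0))"

text \<open>Dependence of rows is a polynomial identity in the positions, so it spreads from a generic point
  to all others.\<close>

lemma generic_dependent_row:
  fixes p q w :: "'v \<Rightarrow> real ^ 'd::finite"
  assumes "finite V" "generic V p" "F \<subseteq> V \<times> V" "e \<in> V \<times> V"
    and dep: "e \<notin> F \<Longrightarrow> \<not> lin_indep (insert e F) (V \<times> UNIV) (rig_row p)"
    and "lin_indep F (V \<times> UNIV) (rig_row q)"
    and "\<And>f. f \<in> F \<Longrightarrow> (q (fst f) - q (snd f)) \<bullet> (w (fst f) - w (snd f)) = 0"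
  shows "(q (fst e) - q (snd e)) \<bullet> (w (fst e) - w (snd e)) = 0"
proof (rule ccontr)
  assume ne: "\<not> ?thesis"
  have finF: "finite F" using assms(1,3) finite_subset by blast
  have e: "e \<notin> F" using assms(7) ne by blast
  \<comment> \<open>The motion \<open>w\<close> separates the row of \<open>e\<close> from those of
    \<open>F\<close> at \<open>q\<close>; this independence would pass to the generic
    \<open>p\<close>.\<close>
  have "lin_indep (insert e F) (V \<times> UNIV) (rig_row q)"
    using assms(3,4,7) ne
    by (intro lin_indep_insertI[OF finF e assms(6), of "coords w"]) (auto simp: sum_rig_row[OF assms(1)])
  then have "lin_indep (insert e F) (V \<times> UNIV) (rig_row (conf (coords q)))" by simp
  then have "lin_indep (insert e F) (V \<times> UNIV) (rig_row (conf (coords p)))"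
    using assms(1-4) finF
    by (intro lin_indep_generic[of "V \<times> UNIV" "coords p" "insert e F" "V \<times> UNIV"
        "\<lambda>z. rig_row (conf z)" "coords q"])
      (auto simp: generic_iff_coords intro!: ratpoly_rig_row)
  with dep e show False by simp
qed

text \<open>The difference of two equivalent configurations is an infinitesimal motion of their midpoint.\<close>

lemma dist_eq_iff_midpoint:
  fixes a b c d :: "'a::real_inner"
  shows "dist c d = dist a b \<longleftrightarrow> (((1/2) *\<^sub>R (a + c)) - ((1/2) *\<^sub>R (b + d))) \<bullet> ((c - a) - (d - b)) = 0"
proof -
  have "dist c d = dist a b \<longleftrightarrow> (c - d) \<bullet> (c - d) = (a - b) \<bullet> (a - b)"
    by (simp add: dist_norm norm_eq)
  also have "\<dots> \<longleftrightarrow> (((1/2) *\<^sub>R (a + c)) - ((1/2) *\<^sub>R (b + d))) \<bullet> ((c - a) - (d - b)) = 0"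
    by (auto simp: inner_diff_left inner_diff_right inner_add_left inner_add_right inner_commute algebra_simps)
  finally show ?thesis .
qed

text \<open>At each vertex a relation between rows is a vanishing combination of edge vectors. Its
  squared length involves only their inner products, which by polarization depend only on pairwise
  distances. This keeps independence available along a motion, whose placements need not be
  generic.\<close>

lemma lin_indep_rig_row_congruent:
  fixes p q :: "'v \<Rightarrow> real ^ 'd::finite"
  assumes "finite V" "F \<subseteq> V \<times> V" and ind: "lin_indep F (V \<times> UNIV) (rig_row p)"
    and cong: "\<And>u v. u \<in> V \<Longrightarrow> v \<in> V \<Longrightarrow> dist (q u) (q v) = dist (p u) (p v)"
  shows "lin_indep F (V \<times> UNIV) (rig_row q)"
proof (rule lin_indepI)
  fix l r
  assume z: "\<And>c. c \<in> V \<times> UNIV \<Longrightarrow> (\<Sum>r\<in>F. l r * rig_row q r c) = 0" and r: "r \<in> F"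
  define d where "d p e = p (fst e) - p (snd e)" for p :: "'v \<Rightarrow> real ^ 'd" and e
  have polar: "(a - b) \<bullet> (x - y) = ((dist a y)\<^sup>2 + (dist b x)\<^sup>2 - (dist a x)\<^sup>2 - (dist b y)\<^sup>2) / 2"
    for a b x y :: "real ^ 'd"
    by (simp add: dist_norm power2_norm_eq_inner inner_diff_left inner_diff_right inner_commute)
  have inner: "d q e \<bullet> d q f = d p e \<bullet> d p f" if "e \<in> F" "f \<in> F" for e f
  proof -
    have "fst e \<in> V" "snd e \<in> V" "fst f \<in> V" "snd f \<in> V" using that assms(2) by auto
    then show ?thesis by (simp add: d_def polar cong)
  qed
  have comp: "(\<Sum>r\<in>F. l r * rig_row p r (x, k)) =
      (\<Sum>r\<in>F. (l r * (of_bool (x = fst r) - of_bool (x = snd r))) *\<^sub>R d p r) $ k" for p x k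
    by (simp add: rig_row_def dir_row_def d_def mult.assoc)
  show "l r = 0"
  proof (rule lin_indepD[OF ind _ r])
    fix c :: "'v \<times> 'd" assume c: "c \<in> V \<times> UNIV"
    obtain x k where xk: "c = (x, k)" by (cases c)
    let ?g = "\<lambda>r. l r * (of_bool (x = fst r) - of_bool (x = snd r))"
    have "(\<Sum>r\<in>F. ?g r *\<^sub>R d q r) = 0"
      unfolding vec_eq_iff comp[symmetric] using z c by (simp add: xk)
    then have "0 = (\<Sum>r\<in>F. ?g r *\<^sub>R d q r) \<bullet> (\<Sum>r\<in>F. ?g r *\<^sub>R d q r)" by simp
    also have "\<dots> = (\<Sum>e\<in>F. \<Sum>f\<in>F. ?g e * (?g f * (d q e \<bullet> d q f)))"
      by (simp add: inner_sum_left inner_sum_right sum_distrib_left inner_commute mult_ac)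
    also have "\<dots> = (\<Sum>e\<in>F. \<Sum>f\<in>F. ?g e * (?g f * (d p e \<bullet> d p f)))"
      by (intro sum.cong refl) (simp add: inner)
    also have "\<dots> = (\<Sum>r\<in>F. ?g r *\<^sub>R d p r) \<bullet> (\<Sum>r\<in>F. ?g r *\<^sub>R d p r)"
      by (simp add: inner_sum_left inner_sum_right sum_distrib_left inner_commute mult_ac)
    finally have "(\<Sum>r\<in>F. ?g r *\<^sub>R d p r) = 0" by simp
    then show "(\<Sum>r\<in>F. l r * rig_row p r c) = 0" by (simp add: xk comp)
  qed
qed

lemma lin_indep_rig_row_open:
  fixes q :: "real \<Rightarrow> 'v \<Rightarrow> real ^ 'd::finite"
  assumes "finite V" "F \<subseteq> V \<times> V" "\<And>v. v \<in> V \<Longrightarrow> continuous_on T (\<lambda>t. q t v)"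
    and "lin_indep F (V \<times> UNIV) (rig_row (q t))" "t \<in> T"
  obtains d where "d > 0" "\<And>s. s \<in> T \<Longrightarrow> dist s t < d \<Longrightarrow> lin_indep F (V \<times> UNIV) (rig_row (q s))"
proof -
  have "\<forall>\<^sub>F s in at t within T. lin_indep F (V \<times> UNIV) (rig_row (q s))"
  proof (rule lin_indep_open)
    show "finite F" using assms(1,2) finite_subset by blast
    show "continuous_on T (\<lambda>t. rig_row (q t) e c)" if "e \<in> F" for e c
      using that assms(2) unfolding rig_row_def dir_row_def
      by (intro continuous_intros assms(3)) auto
  qed (use assms in auto)
  then obtain d where "d > 0" "\<And>s. s \<in> T \<Longrightarrow> s \<noteq> t \<Longrightarrow> dist s t < d \<Longrightarrow> lin_indep F (V \<times> UNIV) (rig_row (q s))"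
    unfolding eventually_at by blast
  then show thesis using assms(4) that by metis
qed

text \<open>Each edge occurs in both orientations. These have equal rows in a rigidity matrix, so an
  independent set of rows contains at most one of them.\<close>

definition edge_rel :: "'v ugraph \<Rightarrow> ('v \<times> 'v) set" where
  "edge_rel G = {(u, v). {u, v} \<in> edges G}"

lemma edge_rel_subset: "fin_graph G \<Longrightarrow> edge_rel G \<subseteq> verts G \<times> verts G"
  by (auto simp: edge_rel_def fin_graph_def)

text \<open>The times at which all distances are the original ones form a clopen set. For openness
  the motion is compared at two nearby times rather than with \<open>p\<close>: the midpoint is then
  close to a placement congruent to \<open>p\<close>, so the rows of \<open>F\<close> are still
  independent there.\<close>

lemma inf_rigid_imp_rigid_framework:
  fixes p :: "'v \<Rightarrow> real ^ 'd::finite"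
  assumes G: "fin_graph G" and p: "generic (verts G) p" and rig: "inf_rigid (verts G) (edge_rel G) p"
  shows "rigid_framework G p"
proof -
  let ?V = "verts G" and ?E = "edge_rel G"
  have V: "finite ?V" using G by (simp add: fin_graph_def)
  have E: "?E \<subseteq> ?V \<times> ?V" using G by (rule edge_rel_subset)
  then have finE: "finite ?E" using V finite_subset by blast
  obtain F where F: "F \<subseteq> ?E" and ind: "lin_indep F (?V \<times> UNIV) (rig_row p)"
    and max: "\<And>e. e \<in> ?E \<Longrightarrow> e \<notin> F \<Longrightarrow> \<not> lin_indep (insert e F) (?V \<times> UNIV) (rig_row p)"
    using ex_max_lin_indep[OF finE] by blast
  have FV: "F \<subseteq> ?V \<times> ?V" and finF: "finite F" using F E finE finite_subset by blast+
  \<comment> \<open>Otherwise the dual vector \<open>b\<close> would be a motion of all edges, by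
    maximality of \<open>F\<close>, that changes the pair \<open>e\<close> to first order.\<close>
  have dep: "\<not> lin_indep (insert e F) (?V \<times> UNIV) (rig_row p)" if e: "e \<in> ?V \<times> ?V" "e \<notin> F" for e
  proof
    assume "lin_indep (insert e F) (?V \<times> UNIV) (rig_row p)"
    then have "\<exists>b. \<forall>r\<in>insert e F. (\<Sum>c\<in>?V \<times> UNIV. rig_row p r c * b c) = of_bool (r = e)"
      by (rule lin_indep_dual[rotated 2]) (use V finF in auto)
    then obtain b where b: "\<And>r. r \<in> insert e F \<Longrightarrow> (\<Sum>c\<in>?V \<times> UNIV. rig_row p r c * b c) = of_bool (r = e)"
      by blast
    have Fb: "(p (fst f) - p (snd f)) \<bullet> (conf b (fst f) - conf b (snd f)) = 0" if "f \<in> F" for f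
      using b[of f] that e FV by (auto simp: sum_rig_row[OF V])
    have "(p (fst f) - p (snd f)) \<bullet> (conf b (fst f) - conf b (snd f)) = 0" if "f \<in> ?E" for f
      by (rule generic_dependent_row[OF V p FV _ _ ind Fb]) (use that E max in auto)
    then have "(p (fst e) - p (snd e)) \<bullet> (conf b (fst e) - conf b (snd e)) = 0"
      using rig e(1) unfolding inf_rigid_def by fastforce
    then show False using b[of e] e(1) by (simp add: sum_rig_row[OF V])
  qed
  show ?thesis unfolding rigid_framework_def
  proof (intro allI impI)
    fix \<gamma> assume \<gamma>: "framework_motion G p \<gamma>"
    have cont: "continuous_on {0..1} (\<lambda>t. \<gamma> t v)" if "v \<in> ?V" for v
      using \<gamma> that by (simp add: framework_motion_def)
    have edge: "dist (\<gamma> t (fst e)) (\<gamma> t (snd e)) = dist (p (fst e)) (p (snd e))"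
      if "e \<in> ?E" "t \<in> {0..1}" for e t
      using \<gamma> that by (auto simp: framework_motion_def edge_rel_def)
    define S where "S = {t\<in>{0..1}. \<forall>u\<in>?V. \<forall>v\<in>?V. dist (\<gamma> t u) (\<gamma> t v) = dist (p u) (p v)}"
    have "S = {0..1} \<inter> (\<Inter>u\<in>?V. \<Inter>v\<in>?V. {t\<in>{0..1}. dist (\<gamma> t u) (\<gamma> t v) = dist (p u) (p v)})"
      by (auto simp: S_def)
    also have "closed \<dots>"
      by (intro closed_Int closed_INT ballI continuous_closed_preimage_constant continuous_intros cont) auto
    finally have "closedin (top_of_set {0..1}) S" by (intro closed_subset) (auto simp: S_def)
    moreover have "openin (top_of_set {0..1}) S"
      unfolding openin_euclidean_subtopology_iff
    proof (intro conjI ballI)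
      fix t assume t: "t \<in> S"
      then have t01: "t \<in> {0..1}" by (simp add: S_def)
      define q where "q s v = (1/2) *\<^sub>R (\<gamma> t v + \<gamma> s v)" for s v
      have "q t = \<gamma> t" by (auto simp: q_def scaleR_2[symmetric])
      moreover have "lin_indep F (?V \<times> UNIV) (rig_row (\<gamma> t))"
        by (rule lin_indep_rig_row_congruent[OF V FV ind]) (use t in \<open>auto simp: S_def\<close>)
      ultimately have "lin_indep F (?V \<times> UNIV) (rig_row (q t))" by simp
      then obtain d where d: "d > 0"
        "\<And>s. s \<in> {0..1} \<Longrightarrow> dist s t < d \<Longrightarrow> lin_indep F (?V \<times> UNIV) (rig_row (q s))"
        by (rule lin_indep_rig_row_open[OF V FV, of "{0..1}" q t, rotated])
          (use t01 in \<open>auto simp: q_def intro!: continuous_intros cont\<close>)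
      have "s \<in> S" if s: "s \<in> {0..1}" "dist s t < d" for s
      proof -
        have "dist (\<gamma> s (fst e)) (\<gamma> s (snd e)) = dist (\<gamma> t (fst e)) (\<gamma> t (snd e))" if e: "e \<in> ?V \<times> ?V" for e
          unfolding dist_eq_iff_midpoint
        proof (fold q_def, rule generic_dependent_row[OF V p FV e dep[OF e] d(2)[OF s]])
          show "(q s (fst f) - q s (snd f)) \<bullet> ((\<gamma> s (fst f) - \<gamma> t (fst f)) - (\<gamma> s (snd f) - \<gamma> t (snd f))) = 0"
            if "f \<in> F" for f
            unfolding q_def dist_eq_iff_midpoint[symmetric]
            using edge[of f] that F s(1) t01 by auto
        qed
        then show ?thesis using t s(1) by (auto simp: S_def)
      qed
      then show "\<exists>e>0. \<forall>x'\<in>{0..1}. dist x' t < e \<longrightarrow> x' \<in> S" using d(1) by blast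
    qed (auto simp: S_def)
    moreover have "0 \<in> S" using \<gamma> by (auto simp: S_def framework_motion_def)
    ultimately have "S = {0..1}"
      using connected_Icc[of "0::real" 1] unfolding connected_clopen by blast
    then show "\<forall>u\<in>?V. \<forall>v\<in>?V. \<forall>t\<in>{0..1}. dist (\<gamma> t u) (\<gamma> t v) = dist (p u) (p v)"
      by (auto simp: S_def)
  qed
qed

text \<open>A nontrivial infinitesimal motion shows that the length of a non-edge is independent of the
  lengths of the edges; at a generic point it can then be varied with these fixed.\<close>

lemma rigid_framework_imp_inf_rigid:
  fixes p :: "'v \<Rightarrow> real ^ 'd::finite"
  assumes G: "fin_graph G" and p: "generic (verts G) p" and rig: "rigid_framework G p"
  shows "inf_rigid (verts G) (edge_rel G) p"
proof (rule ccontr)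
  let ?V = "verts G" and ?E = "edge_rel G"
  assume "\<not> inf_rigid ?V ?E p"
  then obtain w u0 v0 where wE: "\<And>e. e \<in> ?E \<Longrightarrow> (p (fst e) - p (snd e)) \<bullet> (w (fst e) - w (snd e)) = 0"
    and uv: "u0 \<in> ?V" "v0 \<in> ?V" and w0: "(p u0 - p v0) \<bullet> (w u0 - w v0) \<noteq> 0"
    unfolding inf_rigid_def by fastforce
  have V: "finite ?V" using G by (simp add: fin_graph_def)
  have E: "?E \<subseteq> ?V \<times> ?V" using G by (rule edge_rel_subset)
  then have finE: "finite ?E" using V finite_subset by blast
  obtain F where F: "F \<subseteq> ?E" and ind: "lin_indep F (?V \<times> UNIV) (rig_row p)"
    and max: "\<And>e. e \<in> ?E \<Longrightarrow> e \<notin> F \<Longrightarrow> \<not> lin_indep (insert e F) (?V \<times> UNIV) (rig_row p)"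
    using ex_max_lin_indep[OF finE] by blast
  have FV: "F \<subseteq> ?V \<times> ?V" and finF: "finite F" using F E finE finite_subset by blast+
  define e0 where "e0 = (u0, v0)"
  have e0F: "e0 \<notin> F" using wE[of e0] F w0 by (auto simp: e0_def)
  define F' where "F' = insert e0 F"
  have F'V: "F' \<subseteq> ?V \<times> ?V" and finF': "finite F'"
    using FV uv finF by (auto simp: F'_def e0_def)
  have ind': "lin_indep F' (?V \<times> UNIV) (rig_row p)"
    unfolding F'_def
  proof (rule lin_indep_insertI[OF finF e0F ind, of "coords w"])
    show "(\<Sum>c\<in>?V \<times> UNIV. rig_row p f c * coords w c) = 0" if "f \<in> F" for f
      using wE[of f] that F FV by (subst sum_rig_row[OF V]) auto
    show "(\<Sum>c\<in>?V \<times> UNIV. rig_row p e0 c * coords w c) \<noteq> 0"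
      using w0 uv by (subst sum_rig_row[OF V]) (auto simp: e0_def)
  qed
  have "\<exists>b. \<forall>r\<in>F'. (\<Sum>c\<in>?V \<times> UNIV. rig_row p r c * b c) = of_bool (r = s)" if "s \<in> F'" for s
    using that by (intro lin_indep_dual[OF finF' _ ind']) (use V in auto)
  then have "\<forall>s\<in>F'. \<exists>b. \<forall>r\<in>F'. (\<Sum>c\<in>?V \<times> UNIV. rig_row p r c * b c) = of_bool (r = s)" by blast
  from bchoice[OF this] obtain b0 where
    b0: "\<And>r s. r \<in> F' \<Longrightarrow> s \<in> F' \<Longrightarrow> (\<Sum>c\<in>?V \<times> UNIV. rig_row p r c * b0 s c) = of_bool (r = s)"
    by blast
  define b where "b s = conf (b0 s)" for s
  have b: "(p (fst r) - p (snd r)) \<bullet> (b s (fst r) - b s (snd r)) = of_bool (r = s)"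
    if "r \<in> F'" "s \<in> F'" for r s
    using b0[OF that] that F'V by (subst (asm) sum_rig_row[OF V]) (auto simp: b_def)
  obtain h and n :: nat where h: "bij_betw h {..<n} F'"
    using ex_bij_betw_nat_finite[OF finF'] by (auto simp: atLeast0LessThan)
  have hF: "h i \<in> F'" if "i < n" for i using bij_betwE[OF h] that by blast
  \<comment> \<open>The motions \<open>b s\<close> are dual to the rows, so under the displacement
    \<open>x y\<close> the first-order change of half the squared length of edge \<open>h i\<close>
    is exactly \<open>y i\<close>, and the full change is \<open>y i + Q y i\<close>.\<close>
  define x where "x y v = (\<Sum>j<n. y j *\<^sub>R b (h j) v)" for y :: "nat \<Rightarrow> real" and v
  define D where "D i j = b (h j) (fst (h i)) - b (h j) (snd (h i))" for i j
  define X where "X y i = (\<Sum>j<n. y j *\<^sub>R D i j)" for y :: "nat \<Rightarrow> real" and i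
  have X: "X y i = x y (fst (h i)) - x y (snd (h i))" for y i
    by (simp add: X_def x_def D_def algebra_simps sum_subtractf)
  have pX: "(p (fst (h i)) - p (snd (h i))) \<bullet> X y i = y i" if "i < n" for y i
  proof -
    have "(p (fst (h i)) - p (snd (h i))) \<bullet> X y i = (\<Sum>j<n. y j * of_bool (h i = h j))"
      using that hF by (simp add: X_def D_def inner_sum_right b)
    also have "\<dots> = (\<Sum>j<n. if j = i then y j else 0)"
      using bij_betw_imp_inj_on[OF h] that by (intro sum.cong) (auto simp: inj_on_def)
    finally show ?thesis using that by simp
  qed
  define M where "M = (\<Sum>i<n. \<Sum>j<n. norm (D i j))"
  have M: "0 \<le> M" by (simp add: M_def sum_nonneg)
  have XM: "norm (X y i) \<le> r * M" if "i < n" and y: "\<And>j. j < n \<Longrightarrow> \<bar>y j\<bar> \<le> r" for y i r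
  proof -
    have r: "0 \<le> r" using y[OF \<open>i < n\<close>] by linarith
    have "norm (X y i) \<le> (\<Sum>j<n. norm (y j *\<^sub>R D i j))" unfolding X_def by (rule norm_sum)
    also have "\<dots> \<le> (\<Sum>j<n. r * norm (D i j))"
      using y by (intro sum_mono) (auto intro: mult_right_mono)
    also have "\<dots> = r * (\<Sum>j<n. norm (D i j))" by (simp add: sum_distrib_left)
    also have "\<dots> \<le> r * M"
      unfolding M_def using \<open>i < n\<close> r
      by (intro mult_left_mono member_le_sum[of i "{..<n}" "\<lambda>i. \<Sum>j<n. norm (D i j)"]) (auto intro: sum_nonneg)
    finally show ?thesis .
  qed
  define Q where "Q y i = X y i \<bullet> X y i / 2" for y i
  have "\<bar>Q y i - Q y' i\<bar> \<le> M\<^sup>2 * r * s" if i: "i < n" and y: "\<And>j. j < n \<Longrightarrow> \<bar>y j\<bar> \<le> r"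
    and y': "\<And>j. j < n \<Longrightarrow> \<bar>y' j\<bar> \<le> r" and s: "\<And>j. j < n \<Longrightarrow> \<bar>y j - y' j\<bar> \<le> s" for y y' r s i
  proof -
    have "Q y i - Q y' i = X (\<lambda>j. y j + y' j) i \<bullet> X (\<lambda>j. y j - y' j) i / 2"
      by (simp add: Q_def X_def algebra_simps sum.distrib sum_subtractf inner_add_left inner_diff_right
          inner_commute diff_divide_distrib)
    also have "\<bar>\<dots>\<bar> \<le> norm (X (\<lambda>j. y j + y' j) i) * norm (X (\<lambda>j. y j - y' j) i) / 2"
      using Cauchy_Schwarz_ineq2 by (simp add: divide_right_mono)
    also have "\<dots> \<le> ((2 * r) * M) * (s * M) / 2"
    proof (intro divide_right_mono mult_mono XM i)
      show "\<bar>y j + y' j\<bar> \<le> 2 * r" if "j < n" for j using y[OF that] y'[OF that] by linarith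
      show "0 \<le> 2 * r * M" using y[OF i] M by (intro mult_nonneg_nonneg) auto
    qed (use s in auto)
    finally show ?thesis by (simp add: power2_eq_square mult_ac)
  qed
  \<comment> \<open>The right-hand side keeps the lengths in \<open>F\<close> fixed and lets that of
    \<open>e0\<close> grow with \<open>t\<close>.\<close>
  then have "\<exists>\<epsilon>>0. \<exists>Y :: real \<Rightarrow> nat \<Rightarrow> real. \<forall>i<n. continuous_on {0..1} (\<lambda>t. Y t i) \<and> Y 0 i = 0 \<and>
    (\<forall>t\<in>{0..1}. Y t i + Q (Y t) i = t * \<epsilon> * of_bool (h i = e0))"
    by (intro quadratic_curve[of "M\<^sup>2" n Q]) (auto simp: Q_def X_def)
  then obtain \<epsilon> and Y :: "real \<Rightarrow> nat \<Rightarrow> real" where \<epsilon>: "\<epsilon> > 0"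
    and contY: "\<And>i. i < n \<Longrightarrow> continuous_on {0..1} (\<lambda>t. Y t i)" and Y0: "\<And>i. i < n \<Longrightarrow> Y 0 i = 0"
    and Y: "\<And>i t. i < n \<Longrightarrow> t \<in> {0..1} \<Longrightarrow> Y t i + Q (Y t) i = t * \<epsilon> * of_bool (h i = e0)"
    by blast
  define c where "c t v = p v + x (Y t) v" for t v
  have contc: "continuous_on {0..1} (\<lambda>t. c t v)" for v
    unfolding c_def x_def by (intro continuous_intros contY) auto
  have c0: "c 0 = p" by (auto simp: c_def x_def Y0)
  have len: "(dist (c t (fst e)) (c t (snd e)))\<^sup>2 = (dist (p (fst e)) (p (snd e)))\<^sup>2 + 2 * (t * \<epsilon> * of_bool (e = e0))"
    if e: "e \<in> F'" and t: "t \<in> {0..1}" for e t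
  proof -
    obtain i where i: "i < n" "e = h i" using h e by (auto simp: bij_betw_def)
    have "c t (fst e) - c t (snd e) = (p (fst e) - p (snd e)) + X (Y t) i"
      by (simp add: c_def X i(2))
    then have "(dist (c t (fst e)) (c t (snd e)))\<^sup>2 = (dist (p (fst e)) (p (snd e)))\<^sup>2 +
        2 * ((p (fst e) - p (snd e)) \<bullet> X (Y t) i) + X (Y t) i \<bullet> X (Y t) i"
      by (simp add: dist_norm power2_norm_eq_inner inner_add_left inner_add_right inner_commute)
    then show ?thesis using Y[OF i(1) t] pX[OF i(1)] i(2) by (simp add: Q_def)
  qed
  \<comment> \<open>Edges outside \<open>F\<close> are handled at the midpoint of \<open>p\<close>
    and \<open>c t\<close>. The rows of \<open>F\<close> stay independent there for small
    \<open>t\<close>, and \<open>\<tau>\<close> compresses the curve into that range.\<close>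
  define q where "q t v = (1/2) *\<^sub>R (p v + c t v)" for t v
  have "q 0 = p" by (auto simp: q_def c0 scaleR_2[symmetric])
  then have "lin_indep F (?V \<times> UNIV) (rig_row (q 0))" using ind by simp
  then obtain d where d: "d > 0"
    "\<And>s. s \<in> {0..1} \<Longrightarrow> dist s 0 < d \<Longrightarrow> lin_indep F (?V \<times> UNIV) (rig_row (q s))"
    by (rule lin_indep_rig_row_open[OF V FV, of "{0..1}" q 0, rotated])
      (auto simp: q_def intro!: continuous_intros contc)
  define \<tau> where "\<tau> = min 1 (d / 2)"
  have \<tau>: "0 < \<tau>" "\<tau> \<le> 1" "\<tau> < d" using d(1) by (auto simp: \<tau>_def)
  have \<tau>t: "\<tau> * t \<in> {0..1}" "dist (\<tau> * t) 0 < d" if "t \<in> {0..1}" for t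
  proof -
    have "\<tau> * t \<le> \<tau>" "0 \<le> \<tau> * t" using that \<tau> by (auto intro: mult_left_le)
    then show "\<tau> * t \<in> {0..1}" "dist (\<tau> * t) 0 < d"
      unfolding atLeastAtMost_iff dist_real_def using \<tau> by linarith+
  qed
  define \<gamma> where "\<gamma> t = c (\<tau> * t)" for t
  have edge: "dist (\<gamma> t (fst e)) (\<gamma> t (snd e)) = dist (p (fst e)) (p (snd e))"
    if e: "e \<in> ?E" and t: "t \<in> {0..1}" for e t
    unfolding dist_eq_iff_midpoint \<gamma>_def
  proof (fold q_def, rule generic_dependent_row[OF V p FV _ max[OF e] d(2)[OF \<tau>t[OF t]]])
    show "e \<in> ?V \<times> ?V" using e E by blast
    fix f assume f: "f \<in> F"
    then have "(dist (c (\<tau> * t) (fst f)) (c (\<tau> * t) (snd f)))\<^sup>2 = (dist (p (fst f)) (p (snd f)))\<^sup>2"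
      using len[of f "\<tau> * t"] \<tau>t[OF t] e0F by (auto simp: F'_def)
    then have "dist (c (\<tau> * t) (fst f)) (c (\<tau> * t) (snd f)) = dist (p (fst f)) (p (snd f))"
      by (simp add: power2_eq_iff_nonneg)
    then show "(q (\<tau> * t) (fst f) - q (\<tau> * t) (snd f)) \<bullet>
        ((c (\<tau> * t) (fst f) - p (fst f)) - (c (\<tau> * t) (snd f) - p (snd f))) = 0"
      unfolding q_def dist_eq_iff_midpoint[symmetric] .
  qed
  have "framework_motion G p \<gamma>"
    unfolding framework_motion_def
  proof (intro conjI ballI allI impI)
    show "continuous_on {0..1} (\<lambda>t. \<gamma> t v)" for v
      unfolding \<gamma>_def using \<tau>t(1)
      by (intro continuous_on_compose2[OF contc, of _ "\<lambda>t. \<tau> * t"] continuous_intros) auto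
    show "\<gamma> 0 v = p v" for v by (simp add: \<gamma>_def c0)
    show "dist (\<gamma> t u) (\<gamma> t v) = dist (p u) (p v)" if "{u, v} \<in> edges G" "t \<in> {0..1}" for u v t
      using edge[of "(u, v)" t] that by (simp add: edge_rel_def)
  qed
  then have "dist (\<gamma> 1 u0) (\<gamma> 1 v0) = dist (p u0) (p v0)"
    using rig uv unfolding rigid_framework_def by simp
  then have "2 * (\<tau> * \<epsilon>) = 0"
    using len[of e0 \<tau>] \<tau> by (simp add: F'_def \<gamma>_def e0_def)
  with \<tau> \<epsilon> show False by simp
qed


section \<open>Trivial infinitesimal motions\<close>

text \<open>The trivial infinitesimal motions of \<open>p\<close> are spanned by the translations (\<open>Inl\<close>) and the
  rotations in the coordinate planes (\<open>Inr\<close>).\<close>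

definition triv_row :: "('v \<Rightarrow> real ^ 'd) \<Rightarrow> 'd + 'd \<times> 'd \<Rightarrow> 'v \<times> 'd \<Rightarrow> real" where
  "triv_row p t c = (case t of
       Inl k \<Rightarrow> of_bool (snd c = k)
     | Inr kl \<Rightarrow> of_bool (snd c = fst kl) * p (fst c) $ snd kl - of_bool (snd c = snd kl) * p (fst c) $ fst kl)"

definition triv_motion :: "'v set \<Rightarrow> ('v \<Rightarrow> real ^ 'd::finite) \<Rightarrow> ('v \<Rightarrow> real ^ 'd) \<Rightarrow> bool" where
  "triv_motion V p w \<longleftrightarrow> (\<exists>\<mu>. \<forall>c\<in>V \<times> UNIV. coords w c = (\<Sum>t\<in>UNIV. \<mu> t * triv_row p t c))"

lemma triv_row_orthogonal:
  fixes p :: "'v \<Rightarrow> real ^ 'd::finite"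
  shows "(p u - p v) \<bullet> (conf (triv_row p t) u - conf (triv_row p t) v) = 0"
proof (cases t)
  case (Inl k)
  then have "conf (triv_row p t) u = conf (triv_row p t) v"
    by (simp add: conf_def triv_row_def)
  then show ?thesis by simp
next
  case (Inr kl)
  let ?d = "p u - p v"
  have "conf (triv_row p t) u - conf (triv_row p t) v =
      (?d $ snd kl) *\<^sub>R axis (fst kl) 1 - (?d $ fst kl) *\<^sub>R axis (snd kl) 1"
    by (auto simp: vec_eq_iff Inr triv_row_def axis_def)
  then show ?thesis by (simp add: inner_diff_right inner_axis)
qed

lemma ratpoly_triv_row:
  "v \<in> V \<Longrightarrow> ratpoly (V \<times> UNIV) (\<lambda>z :: 'v \<times> 'd::finite \<Rightarrow> real. triv_row (conf z) t (v, k))"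
  by (cases t) (auto simp: triv_row_def simp del: diff_0 intro!: ratpoly_intros)

lemma continuous_on_triv_row:
  fixes p :: "'t::topological_space \<Rightarrow> 'v \<Rightarrow> real ^ 'd::finite"
  shows "continuous_on T (\<lambda>s. p s (fst c)) \<Longrightarrow> continuous_on T (\<lambda>s. triv_row (p s) t c)"
  by (cases t) (auto simp: triv_row_def intro!: continuous_intros)

lemma triv_motionD:
  fixes p :: "'v \<Rightarrow> real ^ 'd::finite"
  assumes "triv_motion V p w" "u \<in> V" "v \<in> V"
  shows "(p u - p v) \<bullet> (w u - w v) = 0"
proof -
  obtain \<mu> where \<mu>: "\<And>c. c \<in> V \<times> UNIV \<Longrightarrow> coords w c = (\<Sum>t\<in>UNIV. \<mu> t * triv_row p t c)"
    using assms(1) unfolding triv_motion_def by blast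
  have "w x = (\<Sum>t\<in>UNIV. \<mu> t *\<^sub>R conf (triv_row p t) x)" if "x \<in> V" for x
    using \<mu>[of "(x, _)"] that by (simp add: vec_eq_iff)
  then have "w u - w v = (\<Sum>t\<in>UNIV. \<mu> t *\<^sub>R (conf (triv_row p t) u - conf (triv_row p t) v))"
    using assms(2,3) by (simp add: sum_subtractf algebra_simps)
  then show ?thesis by (simp add: inner_sum_right triv_row_orthogonal)
qed

lemma triv_motion_skew:
  fixes p w :: "'v \<Rightarrow> real ^ 'd::finite"
  assumes skew: "\<And>k l. A k l = - A l k"
    and w: "\<And>v k. v \<in> V \<Longrightarrow> w v $ k = b k + (\<Sum>l\<in>UNIV. A k l * p v $ l)"
  shows "triv_motion V p w"
  unfolding triv_motion_def
proof (intro exI ballI)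
  fix c :: "'v \<times> 'd" assume "c \<in> V \<times> UNIV"
  then obtain v k where c: "c = (v, k)" and v: "v \<in> V" by blast
  \<comment> \<open>Each rotation plane occurs for both orders of its coordinates, with opposite
    rows, whence the factor 1/2.\<close>
  let ?\<mu> = "\<lambda>t. case t of Inl k \<Rightarrow> b k | Inr kl \<Rightarrow> A (fst kl) (snd kl) / 2"
  have "(\<Sum>t\<in>UNIV. ?\<mu> t * triv_row p t c) = (\<Sum>i\<in>UNIV. b i * of_bool (k = i)) +
      (\<Sum>i\<in>UNIV. \<Sum>j\<in>UNIV. A i j / 2 * (of_bool (k = i) * p v $ j - of_bool (k = j) * p v $ i))"
    by (subst UNIV_Plus_UNIV[symmetric], subst sum.Plus)
      (simp_all add: triv_row_def c sum.cartesian_product split_def)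
  also have "(\<Sum>i\<in>UNIV. b i * of_bool (k = i)) = b k" by simp
  also have "(\<Sum>i\<in>UNIV. \<Sum>j\<in>UNIV. A i j / 2 * (of_bool (k = i) * p v $ j - of_bool (k = j) * p v $ i)) =
     (\<Sum>i\<in>UNIV. of_bool (k = i) * (\<Sum>j\<in>UNIV. A i j / 2 * p v $ j)) -
     (\<Sum>i\<in>UNIV. \<Sum>j\<in>UNIV. of_bool (k = j) * (A i j / 2 * p v $ i))"
    by (simp add: right_diff_distrib sum_subtractf sum_distrib_left mult_ac)
  also have "\<dots> = (\<Sum>j\<in>UNIV. A k j / 2 * p v $ j) - (\<Sum>i\<in>UNIV. A i k / 2 * p v $ i)"
    by (simp add: sum_divide_distrib[symmetric])
  also have "\<dots> = (\<Sum>j\<in>UNIV. A k j * p v $ j)"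
    unfolding sum_subtractf[symmetric] by (intro sum.cong refl) (subst (2) skew, simp add: field_simps)
  finally show "coords w c = (\<Sum>t\<in>UNIV. ?\<mu> t * triv_row p t c)"
    using w[OF v, of k] by (simp add: c)
qed

text \<open>The directions \<open>n\<close> of the edges need not be the differences of the positions \<open>p\<close>, which vanish
  inside the collapsed parts.\<close>

definition dir_rigid :: "'v set \<Rightarrow> ('v \<times> 'v) set \<Rightarrow> ('v \<times> 'v \<Rightarrow> real ^ 'd::finite) \<Rightarrow> ('v \<Rightarrow> real ^ 'd) \<Rightarrow> bool"
  where "dir_rigid V E n p \<longleftrightarrow>
    (\<forall>w. (\<forall>e\<in>E. n e \<bullet> (w (fst e) - w (snd e)) = 0) \<longrightarrow> triv_motion V p w)"

abbreviation edge_dir :: "('v \<Rightarrow> real ^ 'd) \<Rightarrow> 'v \<times> 'v \<Rightarrow> real ^ 'd" where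
  "edge_dir p \<equiv> \<lambda>e. p (fst e) - p (snd e)"

section \<open>Rigidity with prescribed directions as a full-rank condition\<close>

definition ext_row ::
    "('v \<times> 'v \<Rightarrow> real ^ 'd) \<Rightarrow> ('v \<Rightarrow> real ^ 'd) \<Rightarrow> ('v \<times> 'v) + ('d + 'd \<times> 'd) \<Rightarrow> 'v \<times> 'd \<Rightarrow> real" where
  "ext_row n p x = (case x of Inl e \<Rightarrow> dir_row (n e) e | Inr t \<Rightarrow> triv_row p t)"

text \<open>\<open>lin_indep\<close> is used transposed: its coefficients are the coordinates of a
  motion and its columns are the equations, so only the zero motion is orthogonal to every trivial
  one.\<close>

definition dir_indep :: "'v set \<Rightarrow> ('v \<times> 'v) set \<Rightarrow> ('v \<times> 'v \<Rightarrow> real ^ 'd::finite) \<Rightarrow> ('v \<Rightarrow> real ^ 'd) \<Rightarrow> bool"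
  where "dir_indep V E n p \<longleftrightarrow> lin_indep (V \<times> UNIV) (E <+> UNIV) (\<lambda>c x. ext_row n p x c)"

text \<open>A motion orthogonal to all trivial motions is itself trivial, hence orthogonal to
  itself.\<close>

lemma dir_rigid_imp_dir_indep:
  fixes p :: "'v \<Rightarrow> real ^ 'd::finite"
  assumes "finite V" "E \<subseteq> V \<times> V" "dir_rigid V E n p"
  shows "dir_indep V E n p"
  unfolding dir_indep_def
proof (rule lin_indepI)
  fix w c
  assume w: "\<And>x. x \<in> E <+> UNIV \<Longrightarrow> (\<Sum>c\<in>V \<times> UNIV. w c * ext_row n p x c) = 0"
    and c: "c \<in> V \<times> (UNIV :: 'd set)"
  have "n e \<bullet> (conf w (fst e) - conf w (snd e)) = 0" if "e \<in> E" for e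
    using w[OF InlI[OF that]] that sum_dir_row[OF assms(1), of e "n e" w] assms(2)
    by (auto simp: ext_row_def mult.commute)
  then have "triv_motion V p (conf w)" using assms(3) unfolding dir_rigid_def by blast
  then obtain \<mu> where \<mu>: "\<And>c. c \<in> V \<times> UNIV \<Longrightarrow> w c = (\<Sum>t\<in>UNIV. \<mu> t * triv_row p t c)"
    unfolding triv_motion_def by (auto simp: coords_def)
  have "(\<Sum>c\<in>V \<times> UNIV. w c * w c) = (\<Sum>c\<in>V \<times> UNIV. \<Sum>t\<in>UNIV. \<mu> t * (w c * triv_row p t c))"
    by (intro sum.cong refl) (subst (2) \<mu>, auto simp: sum_distrib_left mult_ac)
  also have "\<dots> = (\<Sum>t\<in>UNIV. \<mu> t * (\<Sum>c\<in>V \<times> UNIV. w c * triv_row p t c))"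
    by (subst sum.swap) (simp add: sum_distrib_left)
  also have "\<dots> = 0"
    using w[OF InrI[OF UNIV_I]] by (simp add: ext_row_def)
  finally show "w c = 0"
    using assms(1) c by (subst (asm) sum_nonneg_eq_0_iff) auto
qed

text \<open>A motion minus its projection to the trivial motions is orthogonal to these. By
  \<open>par\<close> trivial motions satisfy the edge equations, so the difference does too and must
  vanish.\<close>

lemma dir_indep_imp_dir_rigid:
  fixes p :: "'v \<Rightarrow> real ^ 'd::finite"
  assumes V: "finite V" and E: "E \<subseteq> V \<times> V" and ind: "dir_indep V E n p"
    and par: "\<And>e. e \<in> E \<Longrightarrow> \<exists>s. n e = s *\<^sub>R (p (fst e) - p (snd e))"
  shows "dir_rigid V E n p"
  unfolding dir_rigid_def
proof (intro allI impI)
  fix w :: "'v \<Rightarrow> real ^ 'd"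
  assume w: "\<forall>e\<in>E. n e \<bullet> (w (fst e) - w (snd e)) = 0"
  obtain \<mu> where \<mu>: "\<And>t. (\<Sum>c\<in>V \<times> UNIV. triv_row p t c *
      (coords w c - (\<Sum>s\<in>UNIV. \<mu> s * triv_row p s c))) = 0"
    using ex_orthogonal_projection[of UNIV "V \<times> UNIV" "triv_row p" "coords w"] V by auto
  define w' where "w' c = coords w c - (\<Sum>s\<in>UNIV. \<mu> s * triv_row p s c)" for c
  have conf_w': "conf w' v = w v - (\<Sum>s\<in>UNIV. \<mu> s *\<^sub>R conf (triv_row p s) v)" for v
    by (simp add: vec_eq_iff w'_def)
  have "w' c = 0" if "c \<in> V \<times> UNIV" for c
  proof (rule lin_indepD[OF ind[unfolded dir_indep_def] _ that])
    fix x :: "('v \<times> 'v) + ('d + 'd \<times> 'd)"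
    assume x: "x \<in> E <+> UNIV"
    show "(\<Sum>c\<in>V \<times> UNIV. w' c * ext_row n p x c) = 0"
    proof (cases x)
      case (Inl e)
      then have e: "e \<in> E" using x by auto
      have "n e \<bullet> (conf (triv_row p s) (fst e) - conf (triv_row p s) (snd e)) = 0" for s
        using par[OF e] by (auto simp: triv_row_orthogonal)
      then have "n e \<bullet> ((\<Sum>s\<in>UNIV. \<mu> s *\<^sub>R conf (triv_row p s) (fst e)) -
          (\<Sum>s\<in>UNIV. \<mu> s *\<^sub>R conf (triv_row p s) (snd e))) = 0"
        by (simp add: sum_subtractf[symmetric] scaleR_diff_right[symmetric] inner_sum_right)
      then have "n e \<bullet> (conf w' (fst e) - conf w' (snd e)) = 0"
        using w e by (simp add: conf_w' inner_diff_right)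
      then show ?thesis
        using sum_dir_row[OF V, of e "n e" w'] e E by (auto simp: Inl ext_row_def mult.commute)
    next
      case (Inr t)
      then show ?thesis using \<mu>[of t] by (simp add: ext_row_def w'_def mult.commute)
    qed
  qed
  then show "triv_motion V p w"
    unfolding triv_motion_def by (intro exI[of _ \<mu>]) (auto simp: w'_def)
qed

lemma dir_rigid_mono: "dir_rigid V E n p \<Longrightarrow> E \<subseteq> E' \<Longrightarrow> dir_rigid V E' n p"
  unfolding dir_rigid_def by blast

lemma dir_rigid_imp_inf_rigid:
  assumes "dir_rigid V E (edge_dir p) p"
  shows "inf_rigid V E p"
  unfolding inf_rigid_def
proof (intro allI impI ballI)
  fix w u v
  assume "\<forall>(u, v)\<in>E. (p u - p v) \<bullet> (w u - w v) = 0" and uv: "u \<in> V" "v \<in> V"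
  then have "triv_motion V p w" using assms unfolding dir_rigid_def by (simp add: split_def)
  then show "(p u - p v) \<bullet> (w u - w v) = 0" using uv by (rule triv_motionD)
qed

lemma dir_rigid_generic:
  fixes p p' :: "'v \<Rightarrow> real ^ 'd::finite"
  assumes V: "finite V" and E: "E \<subseteq> V \<times> V" and p: "generic V p"
    and rig: "dir_rigid V E (edge_dir p') p'"
  shows "dir_rigid V E (edge_dir p) p"
proof (rule dir_indep_imp_dir_rigid[OF V E])
  have finE: "finite E" using V E finite_subset by blast
  have "dir_indep V E (edge_dir (conf (coords p'))) (conf (coords p'))"
    using dir_rigid_imp_dir_indep[OF V E rig] by simp
  then have "dir_indep V E (edge_dir (conf (coords p))) (conf (coords p))"
    unfolding dir_indep_def
  proof (rule lin_indep_generic[where I = "V \<times> UNIV" and z' = "coords p'"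
        and a = "\<lambda>z c x. ext_row (edge_dir (conf z)) (conf z) x c", rotated 4])
    fix c :: "'v \<times> 'd" and x
    assume c: "c \<in> V \<times> UNIV" and x: "x \<in> E <+> (UNIV :: ('d + 'd \<times> 'd) set)"
    show "ratpoly (V \<times> UNIV) (\<lambda>z. ext_row (edge_dir (conf z)) (conf z) x c)"
      using c x E
      by (cases x) (auto simp: ext_row_def dir_row_def intro!: ratpoly_intros ratpoly_triv_row)
  qed (use p V finE in \<open>auto simp: generic_iff_coords\<close>)
  then show "dir_indep V E (edge_dir p) p" by simp
  show "\<exists>s. p (fst e) - p (snd e) = s *\<^sub>R (p (fst e) - p (snd e))" for e
    by (rule exI[of _ 1]) simp
qed

text \<open>At time 0 the directions inside a collapsed part are not multiples of the edge vectors,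
  which vanish there. So only the implication to \<open>dir_indep\<close> is applied at 0; its
  converse, which uses \<open>par\<close>, is applied at a positive time.\<close>

lemma dir_rigid_perturb:
  fixes p :: "real \<Rightarrow> 'v \<Rightarrow> real ^ 'd::finite"
  assumes V: "finite V" and E: "E \<subseteq> V \<times> V" and rig: "dir_rigid V E (n 0) (p 0)"
    and contp: "\<And>v. v \<in> V \<Longrightarrow> continuous_on {0..1} (\<lambda>t. p t v)"
    and contn: "\<And>e. e \<in> E \<Longrightarrow> continuous_on {0..1} (\<lambda>t. n t e)"
    and par: "\<And>t e. t > 0 \<Longrightarrow> e \<in> E \<Longrightarrow> \<exists>s. n t e = s *\<^sub>R (p t (fst e) - p t (snd e))"
  obtains t where "t > 0" "dir_rigid V E (n t) (p t)"
proof -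
  have finE: "finite E" using V E finite_subset by blast
  have "\<forall>\<^sub>F t in at 0 within {0..1}. lin_indep (V \<times> UNIV) (E <+> UNIV) (\<lambda>c x. ext_row (n t) (p t) x c)"
  proof (rule lin_indep_open)
    fix c :: "'v \<times> 'd" and x
    assume c: "c \<in> V \<times> UNIV" and x: "x \<in> E <+> (UNIV :: ('d + 'd \<times> 'd) set)"
    have "continuous_on {0..1} (\<lambda>t. p t (fst c))" using contp c by auto
    then show "continuous_on {0..1} (\<lambda>t. ext_row (n t) (p t) x c)"
      using x E contn
      by (cases x) (auto simp: ext_row_def dir_row_def intro!: continuous_intros continuous_on_triv_row)
  qed (use dir_rigid_imp_dir_indep[OF V E rig] V finE in \<open>auto simp: dir_indep_def\<close>)
  then obtain d where d: "d > 0" "\<And>t. t \<in> {0..1} \<Longrightarrow> t \<noteq> 0 \<Longrightarrow> dist t 0 < d \<Longrightarrow> dir_indep V E (n t) (p t)"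
    unfolding eventually_at dir_indep_def by blast
  define t where "t = min 1 (d / 2)"
  have t: "0 < t" "t \<le> 1" "t < d" using d(1) by (auto simp: t_def)
  show thesis
  proof (rule that[OF t(1)])
    have "dir_indep V E (n t) (p t)" by (rule d(2)) (use t in auto)
    then show "dir_rigid V E (n t) (p t)"
      by (rule dir_indep_imp_dir_rigid[OF V E]) (rule par[OF t(1)])
  qed
qed

text \<open>A placement at the vertices of the standard simplex (with repetitions), where the skew matrix of
  an infinitesimal motion of the complete graph can be read off.\<close>

lemma ex_dir_rigid_complete:
  assumes "CARD('d::finite) \<le> m"
  shows "\<exists>P :: nat \<Rightarrow> real ^ 'd. dir_rigid {1..m} ({1..m} \<times> {1..m}) (edge_dir P) P"
proof -
  have "\<exists>g. bij_betw g {1..CARD('d)} (UNIV :: 'd set)"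
    by (rule ex_bij_betw_nat_finite_1) simp
  then obtain g where "bij_betw g {1..CARD('d)} (UNIV :: 'd set)" ..
  then have "bij_betw (inv_into {1..CARD('d)} g) (UNIV :: 'd set) {1..CARD('d)}"
    by (rule bij_betw_inv_into)
  then obtain h where h: "bij_betw h (UNIV :: 'd set) {1..CARD('d)}" ..
  have inj: "h k = h l \<longleftrightarrow> k = l" for k l using h by (auto simp: bij_betw_def inj_on_def)
  have hm: "h k \<in> {1..m}" for k
    using bij_betwE[OF h] assms by fastforce
  have "1 \<in> {1..CARD('d)}" using zero_less_card_finite[where 'a='d] by simp
  then obtain a where a: "h a = 1" using h unfolding bij_betw_def by (metis imageE)
  \<comment> \<open>Point 1 is the origin, the further ones up to \<open>CARD('d)\<close> are the
    unit vectors other than that of \<open>a\<close>, and all later ones sit at the unit vector of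
    \<open>a\<close>. For \<open>m = CARD('d)\<close> no point leaves the hyperplane orthogonal to
    \<open>a\<close>.\<close>
  define P :: "nat \<Rightarrow> real ^ 'd" where
    "P j = (if j = 1 then 0 else if j \<le> CARD('d) then axis (inv h j) 1 else axis a 1)" for j
  have Ph: "P (h k) = axis k 1" if "k \<noteq> a" for k
  proof -
    have "h k \<noteq> 1" "h k \<le> CARD('d)" using inj that a bij_betwE[OF h] by fastforce+
    then show ?thesis using h by (simp add: P_def bij_betw_imp_inj_on)
  qed
  have Pcases: "j = 1 \<and> P j = 0 \<or> (\<exists>k. k \<noteq> a \<and> j = h k) \<or> j \<noteq> 1 \<and> P j = axis a 1" if "j \<in> {1..m}" for j
  proof (cases "j \<le> CARD('d)")
    case True
    then have "j \<in> range h" using h that by (auto simp: bij_betw_def)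
    then show ?thesis using a by (auto simp: P_def)
  next
    case False
    then show ?thesis by (auto simp: P_def)
  qed
  have m1: "1 \<in> {1..m}" using hm[of a] a by simp
  have "triv_motion {1..m} P w"
    if w: "\<forall>e\<in>{1..m} \<times> {1..m}. (P (fst e) - P (snd e)) \<bullet> (w (fst e) - w (snd e)) = 0" for w
  proof -
    define y where "y j = w j - w 1" for j
    have Pyij: "(P i - P j) \<bullet> (y i - y j) = 0" if "i \<in> {1..m}" "j \<in> {1..m}" for i j
      using w that by (auto simp: y_def)
    have Py0: "P i \<bullet> y i = 0" if "i \<in> {1..m}" for i
      using Pyij[OF that m1] by (simp add: P_def y_def)
    have Py: "P i \<bullet> y j = - (P j \<bullet> y i)" if "i \<in> {1..m}" "j \<in> {1..m}" for i j
      using Pyij[OF that] Py0 that by (simp add: inner_diff_left inner_diff_right)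
    \<comment> \<open>Column \<open>l\<close> is the displacement of the vertex at the unit vector
      of \<open>l\<close>. Column \<open>a\<close> is filled in by skewness, since there may be no
      vertex at that unit vector.\<close>
    define A where "A k l = (if l \<noteq> a then y (h l) $ k else if k \<noteq> a then - y (h k) $ a else 0)" for k l
    have yh: "y (h l) $ k = - y (h k) $ l" if "k \<noteq> a" "l \<noteq> a" for k l
      using Py[OF hm[of k] hm[of l]] by (simp add: Ph that inner_axis inner_axis')
    show ?thesis
    proof (rule triv_motion_skew)
      show "A k l = - A l k" for k l
        using yh[of k l] by (cases "k = a"; cases "l = a") (simp_all add: A_def)
      fix j k assume j: "j \<in> {1..m}"
      have Aaxis: "(\<Sum>l\<in>UNIV. A k l * axis i 1 $ l) = A k i" for i
        by (simp add: axis_def if_distrib[of "\<lambda>x. _ * x"] cong: if_cong)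
      have "y j $ k = (\<Sum>l\<in>UNIV. A k l * P j $ l)"
        using Pcases[OF j]
      proof (elim disjE exE conjE)
        assume "j = 1" "P j = 0"
        then show ?thesis by (simp add: y_def)
      next
        fix l assume l: "l \<noteq> a" "j = h l"
        then have "P j = axis l 1" using Ph by blast
        then show ?thesis using l by (simp only: Aaxis) (simp add: A_def)
      next
        assume Pj: "P j = axis a 1"
        show ?thesis
        proof (cases "k = a")
          case True
          then show ?thesis unfolding Pj Aaxis using Py0[OF j] by (simp add: Pj A_def inner_axis')
        next
          case False
          then show ?thesis unfolding Pj Aaxis using Py[OF hm[of k] j]
            by (simp add: Pj A_def Ph inner_axis')
        qed
      qed
      then show "w j $ k = w 1 $ k + (\<Sum>l\<in>UNIV. A k l * P j $ l)"
        by (simp add: y_def)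
    qed
  qed
  then show ?thesis unfolding dir_rigid_def by blast
qed

text \<open>At \<open>p\<close> all pairs together admit only trivial motions, by transfer from the
  simplex, and infinitesimal rigidity makes a motion of \<open>E\<close> one of all pairs.\<close>

lemma inf_rigid_imp_dir_rigid:
  fixes p q :: "nat \<Rightarrow> real ^ 'd::finite"
  assumes m: "CARD('d) \<le> m" and E: "E \<subseteq> {1..m} \<times> {1..m}"
    and p: "generic {1..m} p" and rig: "inf_rigid {1..m} E p" and q: "generic {1..m} q"
  shows "dir_rigid {1..m} E (edge_dir q) q"
proof -
  let ?K = "{1..m} \<times> {1..m}"
  obtain P :: "nat \<Rightarrow> real ^ 'd" where "dir_rigid {1..m} ?K (edge_dir P) P"
    using ex_dir_rigid_complete[OF m] by (rule exE)
  then have K: "dir_rigid {1..m} ?K (edge_dir p) p"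
    by (rule dir_rigid_generic[OF _ _ p, rotated 2]) auto
  have "dir_rigid {1..m} E (edge_dir p) p"
    unfolding dir_rigid_def
  proof (intro allI impI)
    fix w :: "nat \<Rightarrow> real ^ 'd"
    assume "\<forall>e\<in>E. edge_dir p e \<bullet> (w (fst e) - w (snd e)) = 0"
    then have "\<forall>(u, v)\<in>E. (p u - p v) \<bullet> (w u - w v) = 0" by auto
    then have "\<forall>e\<in>?K. edge_dir p e \<bullet> (w (fst e) - w (snd e)) = 0"
      using rig unfolding inf_rigid_def by auto
    then show "triv_motion {1..m} p w" using K unfolding dir_rigid_def by blast
  qed
  then show ?thesis by (intro dir_rigid_generic[OF _ E q]) auto
qed

section \<open>Anchored graphs\<close>

definition anchored :: "'v set \<Rightarrow> (('v \<times> 'v) \<times> nat) set \<Rightarrow> (nat \<Rightarrow> real ^ 'd::finite) \<Rightarrow> bool" where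
  "anchored V R x \<longleftrightarrow> (\<forall>q. (\<forall>(e, j)\<in>R. x j \<bullet> (q (fst e) - q (snd e)) = 0) \<longrightarrow>
     (\<forall>u\<in>V. \<forall>v\<in>V. q u = q v))"

text \<open>The rows \<open>Inr\<close> pin the vertex \<open>v0\<close> at zero. This removes the
  constant maps, so being anchored becomes the absence of nonzero solutions, again a transposed
  independence.\<close>

definition anchor_row ::
    "'v \<Rightarrow> (nat \<Rightarrow> real ^ 'd) \<Rightarrow> (('v \<times> 'v) \<times> nat) + 'd \<Rightarrow> 'v \<times> 'd \<Rightarrow> real" where
  "anchor_row v0 x r c = (case r of Inl ej \<Rightarrow> dir_row (x (snd ej)) (fst ej) c | Inr k \<Rightarrow> of_bool (c = (v0, k)))"

lemma anchored_iff:
  fixes x :: "nat \<Rightarrow> real ^ 'd::finite"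
  assumes V: "finite V" and R: "fst ` R \<subseteq> V \<times> V" and v0: "v0 \<in> V"
  shows "anchored V R x \<longleftrightarrow> lin_indep (V \<times> UNIV) (R <+> UNIV) (\<lambda>c r. anchor_row v0 x r c)"
proof
  assume anch: "anchored V R x"
  show "lin_indep (V \<times> UNIV) (R <+> UNIV) (\<lambda>c r. anchor_row v0 x r c)"
  proof (rule lin_indepI)
    fix w c
    assume w: "\<And>r. r \<in> R <+> UNIV \<Longrightarrow> (\<Sum>c\<in>V \<times> UNIV. w c * anchor_row v0 x r c) = 0"
      and c: "c \<in> V \<times> (UNIV :: 'd set)"
    have "x j \<bullet> (conf w (fst e) - conf w (snd e)) = 0" if "(e, j) \<in> R" for e j
      using w[OF InlI[OF that]] that sum_dir_row[OF V, of e "x j" w] R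
      by (force simp: anchor_row_def mult.commute)
    then have const: "conf w u = conf w v0" if "u \<in> V" for u
      using anch that v0 unfolding anchored_def by blast
    have "w (v0, k) = 0" for k
      using w[OF InrI[OF UNIV_I, of k]] V v0 by (simp add: anchor_row_def)
    then show "w c = 0"
      using const[of "fst c"] c conf_nth by (metis SigmaE fst_conv)
  qed
next
  assume ind: "lin_indep (V \<times> UNIV) (R <+> UNIV) (\<lambda>c r. anchor_row v0 x r c)"
  show "anchored V R x"
    unfolding anchored_def
  proof (intro allI impI)
    fix q assume q: "\<forall>(e, j)\<in>R. x j \<bullet> (q (fst e) - q (snd e)) = 0"
    define w where "w = coords (\<lambda>v. q v - q v0)"
    have "w c = 0" if "c \<in> V \<times> UNIV" for c
    proof (rule lin_indepD[OF ind _ that])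
      fix r :: "(('a \<times> 'a) \<times> nat) + 'd" assume r: "r \<in> R <+> UNIV"
      show "(\<Sum>c\<in>V \<times> UNIV. w c * anchor_row v0 x r c) = 0"
      proof (cases r)
        case (Inl ej)
        then have ej: "ej \<in> R" using r by auto
        then have "x (snd ej) \<bullet> (q (fst (fst ej)) - q (snd (fst ej))) = 0" using q by auto
        then show ?thesis
          using sum_dir_row[OF V, of "fst ej" "x (snd ej)" w] R ej
          by (auto simp: Inl anchor_row_def mult.commute w_def)
      next
        case (Inr k)
        then show ?thesis using V v0 by (simp add: anchor_row_def w_def)
      qed
    qed
    then have "q u = q v0" if "u \<in> V" for u
      using that by (auto simp: w_def vec_eq_iff)
    then show "\<forall>u\<in>V. \<forall>v\<in>V. q u = q v" by simp
  qed
qed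

lemma anchored_generic:
  fixes P x :: "nat \<Rightarrow> real ^ 'd::finite"
  assumes V: "finite V" and R: "R \<subseteq> (V \<times> V) \<times> (J - {i})" and J: "finite J" and i: "i \<in> J"
    and P: "generic J P" and x: "anchored V R x"
  shows "anchored V R (\<lambda>j. P i - P j)"
proof (cases "V = {}")
  case False
  then obtain v0 where v0: "v0 \<in> V" by blast
  have RV: "fst ` R \<subseteq> V \<times> V" using R by auto
  have finR: "finite R" by (rule finite_subset[OF R]) (use V J in auto)
  \<comment> \<open>Any points assigned to the colours are differences from a point with index
    \<open>i\<close>, as \<open>i\<close> itself is not a colour.\<close>
  define P0 where "P0 j = (if j = i then 0 else - x j)" for j
  have P0: "P0 i - P0 j = x j" if "(e, j) \<in> R" for e j
    using that R by (auto simp: P0_def)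
  have "anchored V R (\<lambda>j. P0 i - P0 j)"
    unfolding anchored_def
  proof (intro allI impI)
    fix q assume "\<forall>(e, j)\<in>R. (P0 i - P0 j) \<bullet> (q (fst e) - q (snd e)) = 0"
    then have "\<forall>(e, j)\<in>R. x j \<bullet> (q (fst e) - q (snd e)) = 0" using P0 by force
    then show "\<forall>u\<in>V. \<forall>v\<in>V. q u = q v" using x unfolding anchored_def by blast
  qed
  then have "lin_indep (V \<times> UNIV) (R <+> UNIV)
      (\<lambda>c r. anchor_row v0 (\<lambda>j. conf (coords P0) i - conf (coords P0) j) r c)"
    by (simp add: anchored_iff[OF V RV v0])
  then have "lin_indep (V \<times> UNIV) (R <+> UNIV)
      (\<lambda>c r. anchor_row v0 (\<lambda>j. conf (coords P) i - conf (coords P) j) r c)"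
  proof (rule lin_indep_generic[where I = "J \<times> UNIV" and z' = "coords P0"
        and a = "\<lambda>z c r. anchor_row v0 (\<lambda>j. conf z i - conf z j) r c", rotated 4])
    fix c :: "'a \<times> 'd" and r
    assume c: "c \<in> V \<times> UNIV" and r: "r \<in> R <+> (UNIV :: 'd set)"
    show "ratpoly (J \<times> UNIV) (\<lambda>z. anchor_row v0 (\<lambda>j. conf z i - conf z j) r c)"
      using r R i
      by (cases r) (auto simp: anchor_row_def dir_row_def intro!: ratpoly_intros)
  qed (use P V finR in \<open>auto simp: generic_iff_coords\<close>)
  then show ?thesis by (simp add: anchored_iff[OF V RV v0])
qed (simp add: anchored_def)


section \<open>Collapsed parts\<close>

text \<open>Each monochromatic cut separates its two sides in the direction of its colour, at a scale that is
  smaller by a factor \<open>t\<close> than that of the preceding cut.\<close>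

lemma ex_separation:
  fixes x :: "nat \<Rightarrow> real ^ 'd::finite" and S :: "nat \<Rightarrow> 'v set set"
  assumes "finite U"
    and "\<And>W. W \<subseteq> U \<Longrightarrow> card W \<ge> 2 \<Longrightarrow> \<exists>j\<in>C. \<exists>U' U''. U' \<noteq> {} \<and> U'' \<noteq> {} \<and> U' \<inter> U'' = {} \<and>
      U' \<union> U'' = W \<and> (\<forall>u\<in>U'. \<forall>v\<in>U''. {u, v} \<in> E \<longrightarrow> {u, v} \<in> S j)"
  shows "\<exists>f :: real \<Rightarrow> 'v \<Rightarrow> real ^ 'd. (\<forall>v\<in>U. continuous_on {0..1} (\<lambda>t. f t v)) \<and>
    (\<forall>u\<in>U. \<forall>v\<in>U. u \<noteq> v \<and> {u, v} \<in> E \<longrightarrow> (\<exists>j\<in>C. {u, v} \<in> S j \<and>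
      (\<exists>s D. s \<noteq> 0 \<and> continuous_on {0..1} D \<and> D 0 = s *\<^sub>R x j \<and> (\<forall>t>0. \<exists>r. D t = r *\<^sub>R (f t u - f t v)))))"
  using assms
proof (induction U rule: finite_psubset_induct)
  case (psubset U)
  let ?P = "\<lambda>f u v. \<exists>j\<in>C. {u, v} \<in> S j \<and>
      (\<exists>s D. s \<noteq> 0 \<and> continuous_on {0..1} D \<and> D 0 = s *\<^sub>R x j \<and> (\<forall>t>0. \<exists>r. D t = r *\<^sub>R (f t u - f t v)))"
  show ?case
  proof (cases "card U \<ge> 2")
    case False
    then have "card U \<le> 1" by simp
    then have "u = v" if "u \<in> U" "v \<in> U" for u v
      using that card_le_Suc0_iff_eq[OF psubset.hyps(1)] by auto
    then show ?thesis by (intro exI[of _ "\<lambda>_ _. 0"]) auto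
  next
    case True
    then obtain j U' U'' where j: "j \<in> C" and U: "U' \<noteq> {}" "U'' \<noteq> {}" "U' \<inter> U'' = {}" "U' \<union> U'' = U"
      and cut: "\<And>u v. u \<in> U' \<Longrightarrow> v \<in> U'' \<Longrightarrow> {u, v} \<in> E \<Longrightarrow> {u, v} \<in> S j"
      using psubset.prems[OF subset_refl True] by blast
    have sub: "U' \<subset> U" "U'' \<subset> U" using U by blast+
    have ex: "\<exists>f :: real \<Rightarrow> 'v \<Rightarrow> real ^ 'd. (\<forall>v\<in>T. continuous_on {0..1} (\<lambda>t. f t v)) \<and>
        (\<forall>u\<in>T. \<forall>v\<in>T. u \<noteq> v \<and> {u, v} \<in> E \<longrightarrow> ?P f u v)" if T: "T \<subset> U" for T
    proof (rule psubset.IH[OF T], rule psubset.prems)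
      show "W \<subseteq> U" if "W \<subseteq> T" for W using that T by blast
    qed
    from ex[OF sub(1)] obtain f' :: "real \<Rightarrow> 'v \<Rightarrow> real ^ 'd" where cont': "\<And>v. v \<in> U' \<Longrightarrow> continuous_on {0..1} (\<lambda>t. f' t v)"
      and f': "\<And>u v. u \<in> U' \<Longrightarrow> v \<in> U' \<Longrightarrow> u \<noteq> v \<Longrightarrow> {u, v} \<in> E \<Longrightarrow> ?P f' u v"
      by (elim exE conjE) blast
    from ex[OF sub(2)] obtain f'' :: "real \<Rightarrow> 'v \<Rightarrow> real ^ 'd" where cont'': "\<And>v. v \<in> U'' \<Longrightarrow> continuous_on {0..1} (\<lambda>t. f'' t v)"
      and f'': "\<And>u v. u \<in> U'' \<Longrightarrow> v \<in> U'' \<Longrightarrow> u \<noteq> v \<Longrightarrow> {u, v} \<in> E \<Longrightarrow> ?P f'' u v"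
      by (elim exE conjE) blast
    \<comment> \<open>At \<open>t = 0\<close> each side shrinks to a point, and the two points
      differ by \<open>x j\<close>.\<close>
    define f where "f t v = (if v \<in> U' then t *\<^sub>R f' t v else t *\<^sub>R f'' t v + x j)" for t v
    have U'': "v \<notin> U'" if "v \<in> U''" for v using that U by blast
    have cont: "continuous_on {0..1} (\<lambda>t. f t v)" if v: "v \<in> U" for v
    proof (cases "v \<in> U'")
      case True
      then show ?thesis by (auto simp: f_def intro!: continuous_intros cont')
    next
      case False
      then have "v \<in> U''" using v U by blast
      with False show ?thesis by (auto simp: f_def intro!: continuous_intros cont'')
    qed
    \<comment> \<open>Within a side the direction \<open>D\<close> is taken over unchanged, the
      factor \<open>t\<close> going into the multiple; across the cut the difference itself is the
      direction.\<close>
    have scale: "?P f u v" if g: "?P g u v" and fg: "\<And>t. f t u - f t v = t *\<^sub>R (g t u - g t v)" for g u v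
    proof -
      obtain i s D where i: "i \<in> C" "{u, v} \<in> S i" "s \<noteq> 0" "continuous_on {0..1} D" "D 0 = s *\<^sub>R x i"
        and D: "\<And>t. t > 0 \<Longrightarrow> \<exists>r. D t = r *\<^sub>R (g t u - g t v)"
        using g by blast
      have "\<exists>r. D t = r *\<^sub>R (f t u - f t v)" if t: "t > 0" for t
      proof -
        obtain r where "D t = r *\<^sub>R (g t u - g t v)" using D[OF t] by blast
        then have "D t = (r / t) *\<^sub>R (f t u - f t v)" using t unfolding fg by simp
        then show ?thesis ..
      qed
      then show ?thesis
        by (intro bexI[OF _ i(1)] conjI exI[of _ s] exI[of _ D] i) blast
    qed
    have across: "?P f u v" if Sj: "{u, v} \<in> S j" and "u \<in> U" "v \<in> U" and s: "s \<noteq> 0" "f 0 u - f 0 v = s *\<^sub>R x j"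
      for u v s
    proof -
      have cont_uv: "continuous_on {0..1} (\<lambda>t. f t u - f t v)"
        using that by (intro continuous_intros cont) auto
      have one: "\<exists>r. f t u - f t v = r *\<^sub>R (f t u - f t v)" for t
        by (rule exI[of _ 1]) simp
      show ?thesis
        by (rule bexI[OF _ j], intro conjI exI[of _ s] exI[of _ "\<lambda>t. f t u - f t v"])
          (rule Sj s cont_uv one allI impI)+
    qed
    have "?P f u v" if "u \<in> U" "v \<in> U" "u \<noteq> v" "{u, v} \<in> E" for u v
    proof (cases "u \<in> U'"; cases "v \<in> U'")
      assume uv: "u \<in> U'" "v \<in> U'"
      show ?thesis
        by (rule scale[OF f'[OF uv that(3,4)]]) (use uv in \<open>simp add: f_def scaleR_diff_right\<close>)
    next
      assume uv: "u \<in> U'" "v \<notin> U'"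
      then have "v \<in> U''" using that(2) U by blast
      with uv that(4) have Sj: "{u, v} \<in> S j" using cut by blast
      have "f 0 u - f 0 v = (-1) *\<^sub>R x j" using uv by (simp add: f_def)
      then show ?thesis by (rule across[OF Sj that(1,2), rotated]) simp
    next
      assume uv: "u \<notin> U'" "v \<in> U'"
      then have u: "u \<in> U''" using that(1) U by blast
      have "{v, u} \<in> E" using that(4) by (subst insert_commute)
      then have "{v, u} \<in> S j" by (rule cut[OF uv(2) u])
      then have Sj: "{u, v} \<in> S j" by (subst insert_commute)
      have "f 0 u - f 0 v = 1 *\<^sub>R x j" using uv by (simp add: f_def)
      then show ?thesis by (rule across[OF Sj that(1,2), rotated]) simp
    next
      assume uv: "u \<notin> U'" "v \<notin> U'"
      then have uv'': "u \<in> U''" "v \<in> U''" using that(1,2) U by blast+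
      show ?thesis
        by (rule scale[OF f''[OF uv'' that(3,4)]]) (use uv in \<open>simp add: f_def scaleR_diff_right\<close>)
    qed
    with cont show ?thesis by (intro exI[of _ f] conjI ballI impI) auto
  qed
qed

section \<open>From the partition to a rigid placement\<close>

lemma connected_in_orthogonal:
  assumes "connected_in H u v" and "\<And>a b. {a, b} \<in> edges H \<Longrightarrow> y \<bullet> (w a - w b) = 0"
  shows "y \<bullet> (w u - w v) = 0"
proof -
  have "(u, v) \<in> {(a, b). {a, b} \<in> edges H}\<^sup>*" using assms(1) by (simp add: connected_in_def)
  then show ?thesis
  proof (induction rule: rtrancl_induct)
    case (step a b)
    then have "y \<bullet> (w u - w a) + y \<bullet> (w a - w b) = 0" using assms(2) by simp
    then show ?case by (simp add: inner_diff_right)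
  qed simp
qed

lemma d_anchored_imp_anchored:
  assumes "d_anchored TYPE('d::finite) (anchoring_graph V n \<G> i)"
  shows "\<exists>x :: nat \<Rightarrow> real ^ 'd. anchored (V i) {((u, v), j). u \<in> V i \<and> v \<in> V i \<and> u \<noteq> v \<and>
    j \<in> {1..n i} - {i} \<and> connected_in (sym_graph \<G> i j) u v} x"
    (is "\<exists>x. anchored _ ?R x")
proof -
  let ?H = "anchoring_graph V n \<G> i"
  obtain x :: "nat \<Rightarrow> real ^ 'd"
    where x: "\<And>q. anchor_motion ?H x q \<Longrightarrow> \<forall>u\<in>mverts ?H. \<forall>v\<in>mverts ?H. q u = q v"
    using assms unfolding d_anchored_def by blast
  have "anchored (V i) ?R x"
    unfolding anchored_def
  proof (intro allI impI)
    fix q assume q: "\<forall>(e, j)\<in>?R. x j \<bullet> (q (fst e) - q (snd e)) = 0"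
    have "anchor_motion ?H x q"
      unfolding anchor_motion_def
    proof (intro ballI allI impI)
      fix e u v assume e: "e \<in> medges ?H" and uv: "mends ?H e = {u, v}"
      obtain a b j where e': "e = ({a, b}, j)" and ab: "((a, b), j) \<in> ?R"
        using e unfolding anchoring_graph_def by auto
      have "x j \<bullet> (q a - q b) = 0" using q ab by fastforce
      moreover have "u = a \<and> v = b \<or> u = b \<and> v = a"
        using uv e' by (auto simp: anchoring_graph_def doubleton_eq_iff)
      ultimately show "(q u - q v) \<bullet> x (mcolour ?H e) = 0"
        by (auto simp: anchoring_graph_def e' inner_diff_left inner_diff_right inner_commute)
    qed
    moreover have "mverts ?H = V i" by (simp add: anchoring_graph_def)
    ultimately show "\<forall>u\<in>V i. \<forall>v\<in>V i. q u = q v" using x by metis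
  qed
  then show ?thesis by - (rule exI, assumption)
qed

lemma generalized_rigid_partition_dir_rigid:
  fixes G :: "'v ugraph"
  assumes G: "fin_graph G" and part: "generalized_rigid_partition TYPE('d::finite) G m V n \<G>"
  shows "\<exists>p :: 'v \<Rightarrow> real ^ 'd. dir_rigid (verts G) (edge_rel G) (edge_dir p) p"
proof -
  let ?I = "index_pairs m n"
  note d1 = part[unfolded generalized_rigid_partition_def]
  note d2 = conjunct2[OF conjunct2[OF d1]] and m = conjunct1[OF d1]
  note d3 = conjunct2[OF d2] and Vdisj = conjunct1[OF d2]
  note d4 = conjunct2[OF d3] and VG = conjunct1[OF d3]
  note d5 = conjunct2[OF d4] and nm = bspec[OF conjunct1[OF d4]]
  note d6 = conjunct2[OF d5] and sub = bspec[OF conjunct1[OF d5]]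
  note d7 = conjunct2[OF d6] and Edisj = conjunct1[OF d6]
  note d8 = conjunct2[OF d7] and vertsG' = bspec[OF conjunct1[OF d7]]
  note d9 = conjunct2[OF d8] and cuts = conjunct1[OF d8, rule_format, OF _ conjI]
  note red = conjunct2[OF d9] and anch = bspec[OF conjunct1[OF d9]]
  have vertsG: "verts (\<G> (i, j)) = (if j \<le> m then V i \<union> V j else V i)" if "(i, j) \<in> ?I" for i j
    using vertsG'[OF that] by simp
  have finG: "finite (verts G)" using G by (simp add: fin_graph_def)
  have finV: "finite (V i)" if "i \<in> {1..m}" for i
    by (rule finite_subset[OF _ finG]) (use VG that in blast)
  \<comment> \<open>\<open>M\<close> bounds all colours, so one generic family serves the parts and
    the extra colours at once.\<close>
  define M where "M = m + (\<Sum>i\<in>{1..m}. n i)"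
  have nM: "n i \<le> M" if "i \<in> {1..m}" for i
    using member_le_sum[of i "{1..m}" n] that by (simp add: M_def)
  obtain P :: "nat \<Rightarrow> real ^ 'd" where P: "generic {1..M} P"
    using ex_generic[of "{1..M}"] by auto

  let ?R = "edge_rel (reduced_graph m V \<G>)"
  have redrig: "dir_rigid {1..m} ?R (edge_dir P) P"
  proof -
    have fin: "fin_graph (reduced_graph m V \<G>)"
      by (auto simp: fin_graph_def reduced_graph_def card_insert_if)
    have verts: "verts (reduced_graph m V \<G>) = {1..m}" by (simp add: reduced_graph_def)
    obtain p0 :: "nat \<Rightarrow> real ^ 'd" where p0: "generic {1..m} p0" "rigid_framework (reduced_graph m V \<G>) p0"
      using red unfolding d_rigid_def verts by blast
    then have "inf_rigid {1..m} ?R p0"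
      using rigid_framework_imp_inf_rigid[OF fin, of p0] by (simp add: verts)
    moreover have "?R \<subseteq> {1..m} \<times> {1..m}" using edge_rel_subset[OF fin] by (simp add: verts)
    moreover have "generic {1..m} P" by (rule generic_mono[OF P]) (auto simp: M_def)
    ultimately show ?thesis using inf_rigid_imp_dir_rigid[OF m _ p0(1)] by blast
  qed

  have anchP: "anchored (V i) {((u, v), j). u \<in> V i \<and> v \<in> V i \<and> u \<noteq> v \<and>
      j \<in> {1..n i} - {i} \<and> connected_in (sym_graph \<G> i j) u v} (\<lambda>j. P i - P j)"
    if i: "i \<in> {1..m}" for i
  proof -
    obtain x :: "nat \<Rightarrow> real ^ 'd" where x: "anchored (V i) {((u, v), j). u \<in> V i \<and> v \<in> V i \<and> u \<noteq> v \<and>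
        j \<in> {1..n i} - {i} \<and> connected_in (sym_graph \<G> i j) u v} x"
      using d_anchored_imp_anchored[OF anch[OF i]] by (elim exE)
    show ?thesis
    proof (rule anchored_generic[OF finV[OF i] _ _ _ P x])
      show "i \<in> {1..M}" using i by (simp add: M_def)
    qed (use nM[OF i] in auto)
  qed

  have pair: "(min i j, max i j) \<in> ?I" "sym_graph \<G> i j = \<G> (min i j, max i j)"
    if "i \<in> {1..m}" "j \<in> {1..n i} - {i}" for i j
    using that nm[of j] by (auto simp: index_pairs_def sym_graph_def min_def max_def)
  have PP: "\<exists>s. s \<noteq> 0 \<and> P i - P j = s *\<^sub>R (P (min i j) - P (max i j))" for i j
  proof (cases "i \<le> j")
    case True
    then show ?thesis by (intro exI[of _ 1]) simp
  next
    case False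
    then show ?thesis by (intro exI[of _ "-1"]) simp
  qed
  have unique: "a = b" if "a \<in> ?I" "b \<in> ?I" "e \<in> edges (\<G> a)" "e \<in> edges (\<G> b)" for a b e
    using Edisj that unfolding disjoint_family_on_def by blast

  define \<pi> where "\<pi> v = (THE i. i \<in> {1..m} \<and> v \<in> V i)" for v
  have \<pi>_eq: "\<pi> v = i" if "i \<in> {1..m}" "v \<in> V i" for v i
    unfolding \<pi>_def
  proof (rule the_equality)
    show "j = i" if "j \<in> {1..m} \<and> v \<in> V j" for j
      using that \<open>i \<in> {1..m}\<close> \<open>v \<in> V i\<close> Vdisj unfolding disjoint_family_on_def by blast
  qed (use that in blast)
  have \<pi>: "\<pi> v \<in> {1..m}" "v \<in> V (\<pi> v)" if v: "v \<in> verts G" for v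
  proof -
    obtain i where i: "i \<in> {1..m}" "v \<in> V i" using v VG by blast
    have \<pi>v: "\<pi> v = i" by (rule \<pi>_eq[OF i])
    show "\<pi> v \<in> {1..m}" unfolding \<pi>v by (rule i(1))
    show "v \<in> V (\<pi> v)" unfolding \<pi>v by (rule i(2))
  qed

  define E where "E = edges (graph_Union ?I \<G>)"
  have E_iff: "e \<in> E \<longleftrightarrow> (\<exists>a\<in>?I. e \<in> edges (\<G> a))" for e by (simp add: E_def graph_Union_def)
  \<comment> \<open>Only these edges have controlled directions; the remaining edges of
    \<open>G\<close> just add equations and are restored at the end.\<close>
  define Er where "Er = {(u, v). {u, v} \<in> E}"
  have edge: "{u, v} \<subseteq> verts (\<G> a)" "u \<noteq> v" "{u, v} \<in> edges G" if "a \<in> ?I" "{u, v} \<in> edges (\<G> a)" for u v a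
    using sub[OF that(1)] that(2) by (auto simp: subgraph_def fin_graph_def)
  have ErG: "Er \<subseteq> edge_rel G" using edge by (auto simp: Er_def E_iff edge_rel_def)
  have GV: "edge_rel G \<subseteq> verts G \<times> verts G" using G by (rule edge_rel_subset)
  have ErV: "Er \<subseteq> verts G \<times> verts G" using ErG GV by blast

  let ?sep = "\<lambda>i f. (\<forall>v\<in>V i. continuous_on {0..1} (\<lambda>t. f t v)) \<and>
    (\<forall>u\<in>V i. \<forall>v\<in>V i. u \<noteq> v \<and> {u, v} \<in> E \<longrightarrow> (\<exists>j\<in>{1..n i} - {i}. {u, v} \<in> edges (sym_graph \<G> i j) \<and>
      (\<exists>s D. s \<noteq> 0 \<and> continuous_on {0..1} D \<and> D 0 = s *\<^sub>R (P i - P j) \<and>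
        (\<forall>t>0. \<exists>r. D t = r *\<^sub>R (f t u - f t v)))))"
  have "\<forall>i\<in>{1..m}. \<exists>f :: real \<Rightarrow> 'v \<Rightarrow> real ^ 'd. ?sep i f"
  proof
    fix i assume i: "i \<in> {1..m}"
    show "\<exists>f :: real \<Rightarrow> 'v \<Rightarrow> real ^ 'd. ?sep i f"
      unfolding E_def by (rule ex_separation[OF finV[OF i]]) (rule cuts[OF i])
  qed
  from bchoice[OF this] obtain f :: "nat \<Rightarrow> real \<Rightarrow> 'v \<Rightarrow> real ^ 'd"
    where f': "\<forall>i\<in>{1..m}. ?sep i (f i)" by (elim exE)
  note contf = bspec[OF conjunct1[OF bspec[OF f']]]
    and sepf = bspec[OF bspec[OF conjunct2[OF bspec[OF f']]], THEN mp, OF _ _ _ conjI]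
  \<comment> \<open>The factor \<open>t\<close> collapses the parts at time 0, while the limiting
    directions of \<open>f\<close> are kept for the edges inside a part.\<close>
  define p where "p t v = P (\<pi> v) + t *\<^sub>R f (\<pi> v) t v" for t v
  have p0: "p 0 v = P (\<pi> v)" for v by (simp add: p_def)
  have contp: "continuous_on {0..1} (\<lambda>t. p t v)" if "v \<in> verts G" for v
    unfolding p_def by (intro continuous_intros contf \<pi> that)

  let ?dir = "\<lambda>e D. \<exists>i j s. (i, j) \<in> ?I \<and> {fst e, snd e} \<in> edges (\<G> (i, j)) \<and> s \<noteq> 0 \<and>
    continuous_on {0..1} D \<and> D 0 = s *\<^sub>R (P i - P j) \<and> (\<forall>t>0. \<exists>r. D t = r *\<^sub>R (p t (fst e) - p t (snd e)))"
  have "\<forall>e\<in>Er. \<exists>D. ?dir e D"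
  proof
    fix e assume eE: "e \<in> Er"
    obtain u v where e: "e = (u, v)" by (cases e)
    have uvE: "{u, v} \<in> E" using eE by (simp add: Er_def e)
    then obtain c where c: "c \<in> ?I" "{u, v} \<in> edges (\<G> c)" using E_iff by blast
    obtain a b where "c = (a, b)" by (cases c)
    with c have ab: "(a, b) \<in> ?I" and uv: "{u, v} \<in> edges (\<G> (a, b))" by simp_all
    have uvG: "u \<in> verts G" "v \<in> verts G" using eE ErV e by blast+
    show "\<exists>D. ?dir e D"
    proof (cases "\<pi> u = \<pi> v")
      case True
      define i where "i = \<pi> u"
      have i: "i \<in> {1..m}" "u \<in> V i" "v \<in> V i"
        using \<pi>[OF uvG(1)] \<pi>(2)[OF uvG(2)] unfolding i_def True by blast+
      obtain j s D where j: "j \<in> {1..n i} - {i}" "{u, v} \<in> edges (sym_graph \<G> i j)"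
        and D: "s \<noteq> 0" "continuous_on {0..1} D" "D 0 = s *\<^sub>R (P i - P j)"
          and D': "\<forall>t>0. \<exists>r. D t = r *\<^sub>R (f i t u - f i t v)"
        using sepf[OF i edge(2)[OF ab uv] uvE] by (elim bexE exE conjE) (rule that, assumption+)
      obtain s' where s': "s' \<noteq> 0" "P i - P j = s' *\<^sub>R (P (min i j) - P (max i j))" using PP by blast
      have par: "\<exists>r. D t = r *\<^sub>R (p t u - p t v)" if t: "t > 0" for t
      proof -
        obtain r where "D t = r *\<^sub>R (f i t u - f i t v)" using D' t by blast
        moreover have "p t u - p t v = t *\<^sub>R (f i t u - f i t v)"
          using True by (simp add: p_def i_def scaleR_diff_right)
        ultimately have "D t = (r / t) *\<^sub>R (p t u - p t v)" using t by simp
        then show ?thesis ..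
      qed
      show ?thesis
        unfolding e fst_conv snd_conv
      proof (intro exI conjI)
        show "(min i j, max i j) \<in> ?I" by (rule pair(1)[OF i(1) j(1)])
        show "{u, v} \<in> edges (\<G> (min i j, max i j))" using j(2) unfolding pair(2)[OF i(1) j(1)] .
        show "s * s' \<noteq> 0" using D(1) s'(1) by simp
        show "continuous_on {0..1} D" by (rule D(2))
        show "D 0 = (s * s') *\<^sub>R (P (min i j) - P (max i j))" using D(3) s'(2) by simp
        show "\<forall>t>0. \<exists>r. D t = r *\<^sub>R (p t u - p t v)" by (intro allI impI par)
      qed
    next
      case False
      have uvab: "{u, v} \<subseteq> (if b \<le> m then V a \<union> V b else V a)"
        using edge(1)[OF ab uv] unfolding vertsG[OF ab] .
      have a: "a \<in> {1..m}" "a < b" using ab by (auto simp: index_pairs_def)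
      have bm: "b \<le> m"
      proof (rule ccontr)
        assume "\<not> b \<le> m"
        with uvab have "u \<in> V a" "v \<in> V a" by auto
        then have "\<pi> u = a" "\<pi> v = a" using \<pi>_eq[OF a(1)] by blast+
        with False show False by simp
      qed
      then have b: "b \<in> {1..m}" using a by simp
      have mem: "u \<in> V a \<union> V b" "v \<in> V a \<union> V b" using uvab bm by simp_all
      have "\<exists>s. s \<noteq> 0 \<and> P (\<pi> u) - P (\<pi> v) = s *\<^sub>R (P a - P b)"
      proof -
        have "\<pi> u = a \<or> \<pi> u = b" "\<pi> v = a \<or> \<pi> v = b"
          using mem \<pi>_eq[OF a(1)] \<pi>_eq[OF b] by blast+
        then have "min (\<pi> u) (\<pi> v) = a" "max (\<pi> u) (\<pi> v) = b" using False a(2) by auto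
        then show ?thesis using PP[of "\<pi> u" "\<pi> v"] by simp
      qed
      then obtain s where s: "s \<noteq> 0" "P (\<pi> u) - P (\<pi> v) = s *\<^sub>R (P a - P b)" by blast
      show ?thesis
        unfolding e fst_conv snd_conv
      proof (intro exI conjI)
        show "(a, b) \<in> ?I" "{u, v} \<in> edges (\<G> (a, b))" "s \<noteq> 0" by (rule ab uv s)+
        show "continuous_on {0..1} (\<lambda>t. p t u - p t v)"
          using uvG by (intro continuous_intros contp)
        show "p 0 u - p 0 v = s *\<^sub>R (P a - P b)" using s(2) by (simp add: p_def)
        show "\<forall>t>0. \<exists>r. p t u - p t v = r *\<^sub>R (p t u - p t v)"
          by (intro allI impI exI[of _ 1]) simp
      qed
    qed
  qed
  from bchoice[OF this] obtain D where D': "\<forall>e\<in>Er. ?dir e (D e)" by (elim exE)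
  note D = bspec[OF D']

  have "dir_rigid (verts G) Er (\<lambda>e. D e 0) (p 0)"
    unfolding dir_rigid_def
  proof (intro allI impI)
    fix w :: "'v \<Rightarrow> real ^ 'd"
    assume w: "\<forall>e\<in>Er. D e 0 \<bullet> (w (fst e) - w (snd e)) = 0"
    \<comment> \<open>The pair recorded with the direction of an edge is the given one, by
      edge-disjointness.\<close>
    have wI: "(P i - P j) \<bullet> (w u - w v) = 0" if ij: "(i, j) \<in> ?I" and uv: "{u, v} \<in> edges (\<G> (i, j))" for i j u v
    proof -
      have e: "(u, v) \<in> Er" using ij uv by (auto simp: Er_def E_iff)
      from D[OF this] obtain i' j' s where "(i', j') \<in> ?I" "{u, v} \<in> edges (\<G> (i', j'))" "s \<noteq> 0"
        "D (u, v) 0 = s *\<^sub>R (P i' - P j')"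
        unfolding fst_conv snd_conv by (elim exE conjE) (rule that, assumption+)
      moreover from this have "(i', j') = (i, j)" using unique ij uv by blast
      ultimately show ?thesis using w e by fastforce
    qed
    have wsym: "(P i - P j) \<bullet> (w u - w v) = 0"
      if ij: "i \<in> {1..m}" "j \<in> {1..n i} - {i}" and uv: "{u, v} \<in> edges (sym_graph \<G> i j)" for i j u v
    proof -
      obtain s where "P i - P j = s *\<^sub>R (P (min i j) - P (max i j))" using PP by blast
      then show ?thesis using wI[OF pair(1)[OF ij], of u v] uv pair(2)[OF ij] by simp
    qed
    have const: "w u = w v" if "i \<in> {1..m}" "u \<in> V i" "v \<in> V i" for i u v
    proof -
      have "(P i - P j) \<bullet> (w a - w b) = 0"
        if "j \<in> {1..n i} - {i}" "connected_in (sym_graph \<G> i j) a b" for a b j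
        by (rule connected_in_orthogonal[OF that(2)]) (rule wsym[OF \<open>i \<in> {1..m}\<close> that(1)])
      then show ?thesis using anchP[OF that(1)] that(2,3) unfolding anchored_def by fastforce
    qed
    \<comment> \<open>Now \<open>w\<close> descends to the parts, and the equations of edges between
      parts become those of the reduced graph at \<open>P\<close>.\<close>
    define \<omega> where "\<omega> i = w (SOME v. v \<in> V i)" for i
    have \<omega>: "w v = \<omega> i" if "i \<in> {1..m}" "v \<in> V i" for i v
      unfolding \<omega>_def using that const[OF that(1)] by (metis someI_ex)
    have "edge_dir P e \<bullet> (\<omega> (fst e) - \<omega> (snd e)) = 0" if "e \<in> ?R" for e
    proof -
      have "{fst e, snd e} \<in> edges (reduced_graph m V \<G>)"
        using that by (auto simp: edge_rel_def)
      then obtain i j u v where ij: "{fst e, snd e} = {i, j}" "i \<in> {1..m}" "j \<in> {1..m}" "i \<noteq> j"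
        and uv: "u \<in> V i" "v \<in> V j" "{u, v} \<in> edges (sym_graph \<G> i j)"
        unfolding reduced_graph_def by auto
      have "(P i - P j) \<bullet> (w u - w v) = 0" using ij uv nm[of i] by (intro wsym) auto
      then have "(P i - P j) \<bullet> (\<omega> i - \<omega> j) = 0" using \<omega> ij uv by simp
      moreover have "fst e = i \<and> snd e = j \<or> fst e = j \<and> snd e = i"
        using ij(1) by (auto simp: doubleton_eq_iff)
      ultimately show ?thesis by (auto simp: inner_diff_left inner_diff_right)
    qed
    then have "triv_motion {1..m} P \<omega>" using redrig unfolding dir_rigid_def by blast
    then obtain \<mu> where \<mu>: "\<And>c. c \<in> {1..m} \<times> UNIV \<Longrightarrow> coords \<omega> c = (\<Sum>t\<in>UNIV. \<mu> t * triv_row P t c)"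
      unfolding triv_motion_def by blast
    have "coords w c = (\<Sum>t\<in>UNIV. \<mu> t * triv_row (p 0) t c)" if cV: "c \<in> verts G \<times> UNIV" for c
    proof -
      obtain v k where c: "c = (v, k)" by (cases c)
      have v: "v \<in> verts G" using cV c by blast
      have "triv_row (p 0) t c = triv_row P t (\<pi> v, k)" for t
        by (cases t) (simp_all add: triv_row_def p0 c)
      moreover have "coords w c = coords \<omega> (\<pi> v, k)"
        unfolding c coords_apply \<omega>[OF \<pi>[OF v]] ..
      moreover have "coords \<omega> (\<pi> v, k) = (\<Sum>t\<in>UNIV. \<mu> t * triv_row P t (\<pi> v, k))"
        by (rule \<mu>) (use \<pi>(1)[OF v] in blast)
      ultimately show ?thesis by simp
    qed
    then show "triv_motion (verts G) (p 0) w" unfolding triv_motion_def by blast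
  qed
  then have rig0: "dir_rigid (verts G) Er ((\<lambda>t e. D e t) 0) (p 0)" by simp
  have contD: "continuous_on {0..1} (D e)" if "e \<in> Er" for e
    using D[OF that] by (elim exE conjE)
  have parD: "\<exists>r. D e t = r *\<^sub>R (p t (fst e) - p t (snd e))" if t: "t > 0" and e: "e \<in> Er" for t e
    using D[OF e] t by blast
  obtain t where t: "t > 0" and rig: "dir_rigid (verts G) Er (\<lambda>e. D e t) (p t)"
    using dir_rigid_perturb[OF finG ErV rig0 contp contD parD] by blast
  \<comment> \<open>Each \<open>D e t\<close> is a multiple, possibly zero, of the edge vector, so
    the equations of the framework imply those with directions \<open>D e t\<close>.\<close>
  have "dir_rigid (verts G) Er (edge_dir (p t)) (p t)"
    unfolding dir_rigid_def
  proof (intro allI impI)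
    fix w assume w: "\<forall>e\<in>Er. edge_dir (p t) e \<bullet> (w (fst e) - w (snd e)) = 0"
    have "D e t \<bullet> (w (fst e) - w (snd e)) = 0" if e: "e \<in> Er" for e
    proof -
      obtain r where "D e t = r *\<^sub>R edge_dir (p t) e" using parD[OF t e] by blast
      then show ?thesis using w e by simp
    qed
    then show "triv_motion (verts G) (p t) w" using rig unfolding dir_rigid_def by blast
  qed
  then show ?thesis using dir_rigid_mono[OF _ ErG] by blast
qed

theorem theorem7p4:
  fixes G :: "'v ugraph"
  assumes "fin_graph G"
    and "\<exists>m V n \<G>. generalized_rigid_partition TYPE('d::finite) G m V n \<G>"
  shows "d_rigid TYPE('d) G"
proof -
  have V: "finite (verts G)" using assms(1) by (simp add: fin_graph_def)
  obtain p' :: "'v \<Rightarrow> real ^ 'd" where p': "dir_rigid (verts G) (edge_rel G) (edge_dir p') p'"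
    using assms generalized_rigid_partition_dir_rigid by blast
  obtain p :: "'v \<Rightarrow> real ^ 'd" where p: "generic (verts G) p" using ex_generic[OF V] by blast
  have "dir_rigid (verts G) (edge_rel G) (edge_dir p) p"
    by (rule dir_rigid_generic[OF V edge_rel_subset[OF assms(1)] p p'])
  then have "inf_rigid (verts G) (edge_rel G) p" by (rule dir_rigid_imp_inf_rigid)
  then have "rigid_framework G p" by (rule inf_rigid_imp_rigid_framework[OF assms(1) p])
  with p show ?thesis unfolding d_rigid_def by blast
qed

end
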